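(* Let $X$ be a Euclidean space, let $m,\ell$ be positive integers, $I:=\{1,\dots,m\}$, $J:=\{1,\dots,\ell\}$, and let $\{C_i\}_{i\in I}$ be closed subsets of $X$ with $C:=\bigcap_{i\in I}C_i\neq\varnothing$. For every $j\in J$ let $\lambda_j,\mu_j\in(0,2]$, $\widehat\beta_j:=\big(\frac{\lambda_j}{2-\lambda_j}+\frac{\mu_j}{2-\mu_j}\big)^{-1}$ (with $\widehat\beta_j:=0$ if $\lambda_j=2$ or $\mu_j=2$), $\alpha_j\in(0,1+\widehat\beta_j)$, and $s_j,t_j\in I$ with $s_j\neq t_j$, such that $\{s_j\}_{j\in J}\cup\{t_j\}_{j\in J}=I$. For $j\in J$ set $T_j:=(1-\alpha_j)\mathrm{Id}+\alpha_jP_{C_{t_j}}^{\mu_j}P_{C_{s_j}}^{\lambda_j}$ and $L_j:=\operatorname{aff}(C_{s_j}\cup C_{t_j})$. Suppose that $C_i$ is convex for every $i\in I$ and that $\bigcap_{i\in I_p}C_i\cap\bigcap_{i\in I\smallsetminus I_p}\operatorname{ri}C_i\neq\varnothing$, where $I_p$ is the set of all $i\in I$ such that $C_i$ and $C_k$ are polyhedral whenever $(i,k)\in\{(s_j,t_j),(t_j,s_j)\}_{j\in J}$. For every $j\in J$ set $$Y_j:=\begin{cases}C_{s_j}\cap C_{t_j}&\text{if }\min\{\lambda_j,\mu_j\}<2,\\(C_{s_j}\cap C_{t_j})+(L_j-L_j)^\perp&\text{if }\lambda_j=\mu_j=2\text{ and }\operatorname{ri}C_{s_j}\cap\operatorname{ri}C_{t_j}\neq\varnothing,\\\operatorname{Fix}T_j&\text{otherwise.}\end{cases}$$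 Then the following hold: (i) Regardless of the starting point $x_0\in X$, the cyclic sequence $(x_n)_{n\in\mathbb{N}}$ generated by $(T_j)_{j\in J}$ converges $R$-linearly to a point $\overline{x}\in\bigcap_{j\in J}Y_j\subseteq\bigcap_{j\in J}\operatorname{Fix}T_j$, while for every $i\in I$ the sequence $(P_{C_i}x_n)_{n\in\mathbb{N}}$ also converges $R$-linearly to $P_{C_i}\overline{x}$. (ii) If $0\in\operatorname{int}(C_{t_j}-C_{s_j})$ whenever $\lambda_j=\mu_j=2$, then the limit point $\overline{x}$ in (i) even satisfies $\overline{x}\in C$. (iii) If the cyclic algorithm is connected and $\operatorname{ri}C_{s_j}\cap\operatorname{ri}C_{t_j}\neq\varnothing$ whenever $\lambda_j=\mu_j=2$, then the limit point $\overline{x}$ in (i) satisfies $P_{C_1}\overline{x}=\cdots=P_{C_m}\overline{x}\in C$. (iv) If the cyclic algorithm is fully connected, then the limit point $\overline{x}$ in (i) satisfies $P_{C_k}\overline{x}\in C$ for some $k\in I$.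
   Context: A Euclidean space is a finite-dimensional real inner product space; $\mathbb{N}=\{0,1,2,\dots\}$. $P_S$ is the nearest-point projector onto a nonempty closed convex set $S$, and $P_S^\lambda:=(1-\lambda)\mathrm{Id}+\lambda P_S$ is the relaxed projector. $\operatorname{ri}$, $\operatorname{int}$, $\operatorname{aff}$ denote relative interior, interior and affine hull; polyhedral sets are finite intersections of closed halfspaces; $\operatorname{Fix}T=\{x:Tx=x\}$. The cyclic sequence generated by $(T_j)_{j\in J}$ from $x_0\in X$ is given by $x_{n+1}=T_{n+1}x_n$ for all $n\in\mathbb{N}$, where $T_{\ell n+j}:=T_j$ for $n\in\mathbb{N}$, $j\in J$. $R$-linear convergence of $(x_n)$ to $\overline{x}$ means that there are $\rho\in[0,1)$ and $\sigma\ge0$ with $\|x_n-\overline{x}\|\le\sigma\rho^n$ for all $n$. The cyclic algorithm is connected if the undirected graph with vertex set $I$ and edges $\{s_j,t_j\}$, $j\in J$, is connected. It is fully connected if there exist integers $1\le r\le q\le\ell$ and (not necessarily distinct) indices $i_1,\dots,i_q\in I$ with $\{i_1,\dots,i_q\}=I$ and $$\{(i_1,i_2),(i_2,i_3),\dots,(i_{r-1},i_r),(i_r,i_1)\}\cup\{(i_1,i_{r+1}),\dots,(i_1,i_q)\}\subseteq\{(s_j,t_j)\}_{j\in J},$$ with the convention that for $r=1$ this reads $\{(i_1,i_2),\dots,(i_1,i_q)\}\subseteq\{(s_j,t_j)\}_{j\in J}$ (the first set is dropped), and for $r=q$ it reads $\{(i_1,i_2),\dots,(i_{r-1},i_r),(i_r,i_1)\}\subseteq\{(s_j,t_j)\}_{j\in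 J}$ (the second set is dropped). *)

theory Defs
  imports "HOL-Analysis.Analysis"
begin

definition relaxed_projector :: "'a::euclidean_space set \<Rightarrow> real \<Rightarrow> 'a \<Rightarrow> 'a" where
  "relaxed_projector S lam x = (1 - lam) *\<^sub>R x + lam *\<^sub>R closest_point S x"

definition beta_hat :: "real \<Rightarrow> real \<Rightarrow> real" where
  "beta_hat lam mu = (if lam = 2 \<or> mu = 2 then 0 else inverse (lam / (2 - lam) + mu / (2 - mu)))"

(* The projection onto A, relaxed by lam, is applied first. *)
definition gDR_operator ::
  "real \<Rightarrow> 'a::euclidean_space set \<Rightarrow> real \<Rightarrow> 'a set \<Rightarrow> real \<Rightarrow> 'a \<Rightarrow> 'a" where
  "gDR_operator \<alpha> A lam B mu x =
     (1 - \<alpha>) *\<^sub>R x + \<alpha> *\<^sub>R relaxed_projector B mu (relaxed_projector A lam x)"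

definition Fix :: "('a \<Rightarrow> 'a) \<Rightarrow> 'a set" where
  "Fix T = {x. T x = x}"

(* On sets, infix minus is set-theoretic difference, while infix plus is the Minkowski sum
   of HOL-Library.Set_Algebras. *)
definition minkowski_diff :: "'a::euclidean_space set \<Rightarrow> 'a set \<Rightarrow> 'a set" where
  "minkowski_diff A B = {a - b | a b. a \<in> A \<and> b \<in> B}"

(* The operators are indexed by 1, ..., l; the index of x (n + 1) is the representative in
   {1..l} of n + 1 modulo l, i.e. n mod l + 1. *)
primrec cyclic_sequence :: "nat \<Rightarrow> (nat \<Rightarrow> 'a \<Rightarrow> 'a) \<Rightarrow> 'a \<Rightarrow> nat \<Rightarrow> 'a" where
  "cyclic_sequence l T x\<^sub>0 0 = x\<^sub>0"
| "cyclic_sequence l T x\<^sub>0 (Suc n) = T (n mod l + 1) (cyclic_sequence l T x\<^sub>0 n)"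

definition converges_R_linearly :: "(nat \<Rightarrow> 'a::euclidean_space) \<Rightarrow> 'a \<Rightarrow> bool" where
  "converges_R_linearly x xbar \<longleftrightarrow>
     (\<exists>\<rho> \<sigma>. 0 \<le> \<rho> \<and> \<rho> < 1 \<and> 0 \<le> \<sigma> \<and> (\<forall>n. norm (x n - xbar) \<le> \<sigma> * \<rho> ^ n))"

definition connected_algorithm ::
  "nat set \<Rightarrow> nat set \<Rightarrow> (nat \<Rightarrow> nat) \<Rightarrow> (nat \<Rightarrow> nat) \<Rightarrow> bool" where
  "connected_algorithm I J s t \<longleftrightarrow>
     (\<forall>u\<in>I. \<forall>v\<in>I. (u, v) \<in> ({(s j, t j) | j. j \<in> J} \<union> {(t j, s j) | j. j \<in> J})\<^sup>*)"

(* A directed cycle through i 1, ..., i r, absent for r = 1, together with edges leaving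
   i 1, absent for r = q. *)
definition fully_connected_algorithm ::
  "nat set \<Rightarrow> nat \<Rightarrow> (nat \<Rightarrow> nat) \<Rightarrow> (nat \<Rightarrow> nat) \<Rightarrow> bool" where
  "fully_connected_algorithm I l s t \<longleftrightarrow>
     (\<exists>r q. \<exists>i :: nat \<Rightarrow> nat. 1 \<le> r \<and> r \<le> q \<and> q \<le> l \<and> i ` {1..q} = I \<and>
        (if r = 1 then {} else {(i k, i (k + 1)) | k. k \<in> {1..<r}} \<union> {(i r, i 1)})
        \<union> {(i 1, i k) | k. k \<in> {r + 1..q}}
        \<subseteq> {(s j, t j) | j. j \<in> {1..l}})"

end

(* Each T j is Fejer monotone with respect to Y j, and on bounded sets the distance to Y j is at most
   a constant times the displacement norm (x - T j x). Together with bounded linear regularity of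
   the family (Y j), which comes from the mixed polyhedral/relative-interior qualification, this makes
   the distance to the intersection contract by a fixed factor over each cycle, and Fejer monotonicity
   turns that into R-linear convergence.

   The error bound has three sources. If min (lam j) (mu j) < 2, the squared-distance decrease in the
   averagedness estimate controls the distances to both sets. For two reflections,
   Fix (T j) = C (s j) \<inter> C (t j) + N with N the polar of C (s j) - C (t j); if the relative
   interiors meet, the part of the displacement along the affine hull is controlled by moving slightly
   beyond a common relative interior point; if both sets are polyhedra, the graph of the projectors
   is a finite union of polyhedra and Hoffman's bound applies to each piece. *)

theory Submission
  imports Defs
begin

section \<open>Polyhedra and linear regularity\<close>

text \<open>One point of the qualified intersection is used throughout. By the choice of
  \<open>I\<^sub>p\<close>, a pair with an index in \<open>I\<^sub>p\<close> consists of two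
  polyhedra, and for every other pair the point is relatively interior to both sets, so a pair
  mixing the two kinds never has to be treated. The delicate point is that regularity enters twice:
  for each pair, and again for the family of the \<open>Y j\<close>, whose members may be larger
  than \<open>C (s j) \<inter> C (t j)\<close>. Hence the same point must qualify for
  \<open>Y j\<close> too, which is why fixed point sets of polyhedral reflections are shown to be
  polyhedra and relative interiors of sums are computed. In the under-relaxed case the decrease
  estimate is only quadratic: squared residuals are bounded by displacement times distance.
  Regularity feeds the same distance back, and the resulting inequality is solved for it. The number
  \<open>beta_hat\<close> comes from a weighted Cauchy-Schwarz inequality for the two residuals; it
  is zero once a reflection is involved, and then plain nonexpansiveness replaces
  averagedness.\<close>

lemma finite_uniform_bound:
  fixes P :: "'i \<Rightarrow> real \<Rightarrow> bool"
  assumes "finite S"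
    and "\<And>i. i \<in> S \<Longrightarrow> \<exists>k\<ge>0. P i k"
    and "\<And>i k k'. i \<in> S \<Longrightarrow> P i k \<Longrightarrow> 0 \<le> k \<Longrightarrow> k \<le> k' \<Longrightarrow> P i k'"
  shows "\<exists>k\<ge>0. \<forall>i\<in>S. P i k"
proof -
  obtain f where f: "\<And>i. i \<in> S \<Longrightarrow> 0 \<le> f i \<and> P i (f i)"
    using assms(2) by metis
  \<comment> \<open>The sum replaces a maximum, so the empty index set is no special case.\<close>
  have "f i \<le> sum f S" if "i \<in> S" for i
    using f that assms(1) by (intro member_le_sum) auto
  then show ?thesis
    using f assms(3) sum_nonneg[of S f] by (intro exI[of _ "sum f S"]) blast
qed

text \<open>Unit normals make residuals comparable with distances: a point at distance
  \<open>e\<close> from the polyhedron violates each inequality by at most \<open>e\<close>.\<close>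

lemma polyhedron_normalized_inequalities:
  fixes S :: "'a::euclidean_space set"
  assumes "polyhedron S"
  obtains H :: "('a \<times> real) set"
  where "finite H" "\<And>a b. (a, b) \<in> H \<Longrightarrow> norm a = 1" "S = {x. \<forall>(a,b)\<in>H. a \<bullet> x \<le> b}"
proof -
  obtain F where F: "finite F" "S = \<Inter>F" "\<forall>h\<in>F. \<exists>a b. a \<noteq> 0 \<and> h = {x. a \<bullet> x \<le> b}"
    using assms unfolding polyhedron_def by blast
  have "\<exists>p. norm (fst p) = 1 \<and> h = {x. fst p \<bullet> x \<le> snd p}" if h: "h \<in> F" for h
  proof -
    obtain a b where ab: "a \<noteq> 0" "h = {x. a \<bullet> x \<le> b}" using F(3) h by blast
    show ?thesis
      by (rule exI[of _ "(a /\<^sub>R norm a, b / norm a)"])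
         (use ab in \<open>auto simp: divide_simps mult.commute\<close>)
  qed
  then obtain p where p: "\<And>h. h \<in> F \<Longrightarrow> norm (fst (p h)) = 1 \<and> h = {x. fst (p h) \<bullet> x \<le> snd (p h)}"
    by metis
  show ?thesis
  proof
    show "finite (p ` F)" using F(1) by simp
    show "norm a = 1" if "(a, b) \<in> p ` F" for a b using p that by (metis fst_conv imageE)
    have "S = {x. \<forall>h\<in>F. fst (p h) \<bullet> x \<le> snd (p h)}"
      unfolding F(2) using p by blast
    then show "S = {x. \<forall>(a,b)\<in>p ` F. a \<bullet> x \<le> b}"
      by (auto simp: case_prod_unfold)
  qed
qed

text \<open>The adjoint pulls each halfspace back to a halfspace. Orthogonal sums and graph pieces
  are later written as intersections of such affine preimages.\<close>

lemma polyhedron_linear_preimage: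
  fixes f :: "'a::euclidean_space \<Rightarrow> 'b::euclidean_space"
  assumes "linear f" "polyhedron S"
  shows "polyhedron {x. f x + c \<in> S}"
proof -
  obtain H where H: "finite H" "S = {x. \<forall>(a,b)\<in>H. a \<bullet> x \<le> b}"
    by (rule polyhedron_normalized_inequalities[OF assms(2)]) blast
  have "{x. f x + c \<in> S} = (\<Inter>p\<in>H. {x. adjoint f (fst p) \<bullet> x \<le> snd p - fst p \<bullet> c})"
    unfolding H(2) by (auto simp: adjoint_works[OF assms(1)] inner_add_right le_diff_eq case_prod_unfold
        inner_commute[of "adjoint f _"] inner_commute[of "f _"])
  then show ?thesis
    using H(1) by (auto intro!: polyhedron_Inter polyhedron_halfspace_le)
qed

section \<open>Finite systems of linear inequalities: Farkas' lemma and Hoffman's bound\<close>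

lemma feasible_direction_finite_inequalities:
  fixes H :: "('a::euclidean_space \<times> real) set"
  assumes "finite H" and z: "\<forall>(a,b)\<in>H. a \<bullet> z \<le> b"
    and w: "\<forall>(a,b)\<in>H. a \<bullet> z = b \<longrightarrow> a \<bullet> w \<le> 0"
  shows "\<exists>t>0. \<forall>(a,b)\<in>H. a \<bullet> (z + t *\<^sub>R w) \<le> b"
proof -
  \<comment> \<open>\<open>t * k \<le> 1\<close> encodes the step bound
    \<open>t \<le> 1 / k\<close>, with \<open>k = 0\<close> for no restriction, so that the bounds
    are monotone in \<open>k\<close> and can be merged over \<open>H\<close>.\<close>
  have "\<exists>k\<ge>0. \<forall>p\<in>H. \<forall>t>0. t * k \<le> 1 \<longrightarrow> fst p \<bullet> (z + t *\<^sub>R w) \<le> snd p"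
  proof (rule finite_uniform_bound[OF assms(1)])
    fix p assume p: "p \<in> H"
    obtain a b where ab: "p = (a,b)" by force
    show "\<exists>k\<ge>0. \<forall>t>0. t * k \<le> 1 \<longrightarrow> fst p \<bullet> (z + t *\<^sub>R w) \<le> snd p"
    proof (cases "a \<bullet> w \<le> 0")
      case True
      then have "a \<bullet> (z + t *\<^sub>R w) \<le> b" if "t > 0" for t
      proof -
        have "a \<bullet> z \<le> b" using z p ab by blast
        moreover have "t * (a \<bullet> w) \<le> 0" using True that by (simp add: mult_nonneg_nonpos)
        ultimately show ?thesis by (simp add: inner_add_right)
      qed
      then show ?thesis by (auto simp: ab)
    next
      case False
      then have "a \<bullet> z < b" using z w p ab by fastforce
      then show ?thesis using False
        by (intro exI[of _ "(a \<bullet> w) / (b - a \<bullet> z)"]) (auto simp: ab inner_add_right field_simps)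
    qed
  next
    fix p k k' assume *: "\<forall>t>0. t * k \<le> 1 \<longrightarrow> fst p \<bullet> (z + t *\<^sub>R w) \<le> snd p" "0 \<le> k" "k \<le> k'"
    show "\<forall>t>0. t * k' \<le> 1 \<longrightarrow> fst p \<bullet> (z + t *\<^sub>R w) \<le> snd p"
      using * by (smt (verit) mult_left_mono)
  qed
  then obtain k where "k \<ge> 0" "\<forall>p\<in>H. \<forall>t>0. t * k \<le> 1 \<longrightarrow> fst p \<bullet> (z + t *\<^sub>R w) \<le> snd p" by blast
  then show ?thesis
    by (intro exI[of _ "1 / (k + 1)"]) (auto simp: divide_simps)
qed

text \<open>Farkas' lemma by separation: if \<open>u\<close> were outside the closed cone, a
  separating \<open>w\<close> would make \<open>- w\<close> nonpositive on all active normals, hence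
  feasible for a short step, while \<open>u\<close> strictly increases along it.\<close>

lemma normal_vector_mem_convex_cone_hull_active:
  fixes H :: "('a::euclidean_space \<times> real) set"
  assumes "finite H" and z: "\<forall>(a,b)\<in>H. a \<bullet> z \<le> b"
    and u: "\<And>y. \<forall>(a,b)\<in>H. a \<bullet> y \<le> b \<Longrightarrow> u \<bullet> (y - z) \<le> 0"
  shows "u \<in> convex_cone hull (fst ` {p \<in> H. fst p \<bullet> z = snd p})" (is "_ \<in> ?N")
proof (rule ccontr)
  assume "u \<notin> ?N"
  moreover have "closed ?N" "convex ?N"
    using assms(1) by (auto intro: closed_convex_cone_hull convex_convex_cone_hull)
  ultimately obtain w c where w: "w \<bullet> u < c" "\<forall>x\<in>?N. c < w \<bullet> x"
    using separating_hyperplane_closed_point by blast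
  have "c < 0" using w(2) convex_cone_hull_contains_0[of "fst ` {p \<in> H. fst p \<bullet> z = snd p}"] by fastforce
  \<comment> \<open>Separation only gives the lower bound \<open>c\<close>; a cone is closed under
    positive scaling, so a negative value could be scaled to equal \<open>c\<close> exactly.\<close>
  have nn: "0 \<le> w \<bullet> x" if x: "x \<in> ?N" for x
  proof (rule ccontr)
    assume "\<not> 0 \<le> w \<bullet> x"
    then have neg: "w \<bullet> x < 0" by simp
    then have "(c / (w \<bullet> x)) *\<^sub>R x \<in> ?N"
      using \<open>c < 0\<close> by (intro convex_cone_hull_mul[OF x]) (simp add: divide_nonpos_neg)
    then have "c < w \<bullet> ((c / (w \<bullet> x)) *\<^sub>R x)" using w(2) by blast
    then show False using neg by simp
  qed
  have "a \<bullet> (- w) \<le> 0" if "(a, b) \<in> H" "a \<bullet> z = b" for a b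
  proof -
    have "a \<in> ?N" using that by (intro hull_inc) force
    then show ?thesis using nn[of a] by (simp add: inner_commute)
  qed
  then have "\<forall>(a,b)\<in>H. a \<bullet> z = b \<longrightarrow> a \<bullet> (- w) \<le> 0" by blast
  then obtain t where t: "t > 0" "\<forall>(a,b)\<in>H. a \<bullet> (z + t *\<^sub>R (- w)) \<le> b"
    using feasible_direction_finite_inequalities[OF assms(1) z, of "- w"] by blast
  have "u \<bullet> (t *\<^sub>R (- w)) \<le> 0" using u[OF t(2)] by simp
  then have "0 \<le> w \<bullet> u" using t(1) by (simp add: inner_commute zero_le_mult_iff)
  then show False using w(1) \<open>c < 0\<close> by simp
qed

text \<open>A unit vector \<open>d\<close> in the polar of the cone cut out by \<open>K\<close>
  cannot lie in that cone, as then \<open>d \<bullet> d \<le> 0\<close>. So the sum of positive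
  parts is positive on a compact set and has a positive minimum there.\<close>

lemma hoffman_direction_bound:
  fixes K :: "('a::euclidean_space \<times> real) set"
  assumes "finite K"
  shows "\<exists>k\<ge>0. \<forall>d. norm d = 1 \<longrightarrow> (\<forall>w. (\<forall>(a,b)\<in>K. a \<bullet> w \<le> 0) \<longrightarrow> d \<bullet> w \<le> 0)
           \<longrightarrow> 1 \<le> k * (\<Sum>(a,b)\<in>K. max 0 (a \<bullet> d))"
proof -
  define S where "S = sphere 0 1 \<inter> (\<Inter>w\<in>{w. \<forall>(a,b)\<in>K. a \<bullet> w \<le> 0}. {d. w \<bullet> d \<le> 0})"
  define f :: "'a \<Rightarrow> real" where "f d = (\<Sum>(a,b)\<in>K. max 0 (a \<bullet> d))" for d
  have mem: "d \<in> S \<longleftrightarrow> norm d = 1 \<and> (\<forall>w. (\<forall>(a,b)\<in>K. a \<bullet> w \<le> 0) \<longrightarrow> d \<bullet> w \<le> 0)" for d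
    unfolding S_def by (auto simp: inner_commute)
  have cpt: "compact S"
    unfolding S_def by (intro compact_Int_closed closed_INT ballI closed_halfspace_le) auto
  have pos: "f d > 0" if d: "d \<in> S" for d
  proof (rule ccontr)
    assume "\<not> f d > 0"
    moreover have "f d \<ge> 0" unfolding f_def by (intro sum_nonneg) auto
    ultimately have "(\<Sum>p\<in>K. max 0 (fst p \<bullet> d)) = 0" unfolding f_def by (simp add: case_prod_unfold)
    then have "\<forall>p\<in>K. max 0 (fst p \<bullet> d) = 0"
      using assms by (subst (asm) sum_nonneg_eq_0_iff) auto
    then have "\<forall>(a,b)\<in>K. a \<bullet> d \<le> 0" by (auto simp: max_def split: if_splits)
    then have "d \<bullet> d \<le> 0" using d mem by blast
    moreover have "d \<bullet> d = 1" using d mem by (simp add: dot_square_norm)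
    ultimately show False by simp
  qed
  show ?thesis
  proof (cases "S = {}")
    case True then show ?thesis using mem by (intro exI[of _ 0]) blast
  next
    case False
    have "continuous_on S f" unfolding f_def case_prod_unfold by (intro continuous_intros)
    then obtain e where e: "e \<in> S" "\<forall>d\<in>S. f e \<le> f d"
      using continuous_attains_inf[OF cpt False] by blast
    have "1 \<le> (1 / f e) * f d" if "d \<in> S" for d
      using pos[OF e(1)] e(2) that by (simp add: field_simps)
    then show ?thesis using pos[OF e(1)] mem unfolding f_def
      by (intro exI[of _ "1 / f e"]) (auto simp: f_def)
  qed
qed

text \<open>Hoffman's bound. The displacement from \<open>x\<close> to its projection lies in the polar of the
  tangent cone cut out by the active inequalities, so compactness of the unit sphere bounds some
  active residual from below; only finitely many active sets occur.\<close>

lemma hoffman_finite_inequalities: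
  fixes H :: "('a::euclidean_space \<times> real) set"
  assumes fin: "finite H" and ne: "{z. \<forall>(a,b)\<in>H. a \<bullet> z \<le> b} \<noteq> {}"
  shows "\<exists>k\<ge>0. \<forall>x e. 0 \<le> e \<longrightarrow> (\<forall>(a,b)\<in>H. a \<bullet> x \<le> b + e) \<longrightarrow>
           (\<exists>z. (\<forall>(a,b)\<in>H. a \<bullet> z \<le> b) \<and> norm (x - z) \<le> k * e)"
proof -
  define Z where "Z = {z. \<forall>(a,b)\<in>H. a \<bullet> z \<le> b}"
  have Zeq: "Z = (\<Inter>p\<in>H. {z. fst p \<bullet> z \<le> snd p})"
    unfolding Z_def by (auto simp: case_prod_unfold)
  have Z: "closed Z" "convex Z"
    unfolding Zeq by (auto intro!: closed_INT convex_INT closed_halfspace_le convex_halfspace_le)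
  \<comment> \<open>The active set at the projection varies with the point, so one constant is fixed
    beforehand for all subsets of \<open>H\<close>.\<close>
  define P where "P K k \<longleftrightarrow> (\<forall>d::'a. norm d = 1 \<longrightarrow> (\<forall>w. (\<forall>(a,b)\<in>K. a \<bullet> w \<le> 0) \<longrightarrow> d \<bullet> w \<le> 0)
           \<longrightarrow> 1 \<le> k * (\<Sum>(a,b)\<in>K. max 0 (a \<bullet> d)))" for K :: "('a \<times> real) set" and k :: real
  have "\<exists>k\<ge>0. \<forall>K\<in>Pow H. P K k"
  proof (rule finite_uniform_bound)
    show "finite (Pow H)" using fin by simp
    show "\<exists>k\<ge>0. P K k" if "K \<in> Pow H" for K
      unfolding P_def using hoffman_direction_bound[of K] that fin finite_subset by blast
    show "P K k'" if "P K k" "0 \<le> k" "k \<le> k'" for K k k'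
      unfolding P_def
    proof (intro allI impI)
      fix d :: 'a assume d: "norm d = 1" "\<forall>w. (\<forall>(a,b)\<in>K. a \<bullet> w \<le> 0) \<longrightarrow> d \<bullet> w \<le> 0"
      have "0 \<le> (\<Sum>(a,b)\<in>K. max 0 (a \<bullet> d))" by (intro sum_nonneg) auto
      then have "k * (\<Sum>(a,b)\<in>K. max 0 (a \<bullet> d)) \<le> k' * (\<Sum>(a,b)\<in>K. max 0 (a \<bullet> d))"
        using that by (intro mult_right_mono)
      moreover have "1 \<le> k * (\<Sum>(a,b)\<in>K. max 0 (a \<bullet> d))"
        using that(1) d unfolding P_def by blast
      ultimately show "1 \<le> k' * (\<Sum>(a,b)\<in>K. max 0 (a \<bullet> d))" by linarith
    qed
  qed
  then obtain k where k: "k \<ge> 0" "\<And>K. K \<subseteq> H \<Longrightarrow> P K k" by auto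
  show ?thesis
  proof (intro exI[of _ "k * card H"] conjI allI impI)
    show "0 \<le> k * card H" using k by simp
    fix x e assume e: "0 \<le> (e::real)" and x: "\<forall>(a,b)\<in>H. a \<bullet> x \<le> b + e"
    define z where "z = closest_point Z x"
    have zZ: "z \<in> Z" unfolding z_def using Z ne by (intro closest_point_in_set) (auto simp: Z_def)
    have "norm (x - z) \<le> k * card H * e"
    proof (cases "x = z")
      case True then show ?thesis using k e by simp
    next
      case False
      define \<tau> where "\<tau> = norm (x - z)"
      define d where "d = (x - z) /\<^sub>R \<tau>"
      define K where "K = {p \<in> H. fst p \<bullet> z = snd p}"
      have \<tau>: "\<tau> > 0" using False by (simp add: \<tau>_def)
      have xd: "x = z + \<tau> *\<^sub>R d" using \<tau> by (simp add: d_def)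
      have pol: "d \<bullet> w \<le> 0" if w: "\<forall>(a,b)\<in>K. a \<bullet> w \<le> 0" for w
      proof -
        have "\<exists>t>0. \<forall>(a,b)\<in>H. a \<bullet> (z + t *\<^sub>R w) \<le> b"
          using zZ w by (intro feasible_direction_finite_inequalities fin) (auto simp: Z_def K_def)
        then obtain t where t: "t > 0" "z + t *\<^sub>R w \<in> Z" unfolding Z_def by blast
        have "(x - z) \<bullet> (z + t *\<^sub>R w - z) \<le> 0"
          unfolding z_def using closest_point_dot[OF Z(2,1) t(2)[unfolded z_def]] .
        then have "t * ((x - z) \<bullet> w) \<le> 0" by simp
        then have "(x - z) \<bullet> w \<le> 0" using t(1) by (simp add: mult_le_0_iff)
        then show ?thesis using \<tau> by (simp add: d_def mult_nonneg_nonpos)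
      qed
      have "norm d = 1" using \<tau> by (simp add: d_def \<tau>_def)
      then have "1 \<le> k * (\<Sum>(a,b)\<in>K. max 0 (a \<bullet> d))"
        using k(2)[of K] pol unfolding P_def K_def by blast
      \<comment> \<open>An active inequality is tight at \<open>z\<close> and violated by at most
        \<open>e\<close> at \<open>x\<close>, which lies \<open>\<tau>\<close> further along
        \<open>d\<close>, so its slope along \<open>d\<close> is at most \<open>e / \<tau>\<close>.
        Summing over at most \<open>card H\<close> of them gives the factor in the final
        constant.\<close>
      also have "\<dots> \<le> k * (\<Sum>p\<in>K. e / \<tau>)"
      proof (intro mult_left_mono sum_mono k(1))
        fix p assume p: "p \<in> K"
        have "fst p \<bullet> x \<le> snd p + e" "fst p \<bullet> z = snd p" using p x by (auto simp: K_def)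
        then have "\<tau> * (fst p \<bullet> d) \<le> e" using xd by (simp add: inner_add_right)
        then show "(case p of (a, b) \<Rightarrow> max 0 (a \<bullet> d)) \<le> e / \<tau>"
          using \<tau> e by (simp add: case_prod_unfold field_simps)
      qed
      also have "\<dots> \<le> k * (card H * (e / \<tau>))"
      proof -
        have "card K \<le> card H" using fin by (intro card_mono) (auto simp: K_def)
        then have "card K * (e / \<tau>) \<le> card H * (e / \<tau>)" using e \<tau> by (intro mult_right_mono) auto
        then show ?thesis unfolding sum_constant by (rule mult_left_mono[OF _ k(1)])
      qed
      finally have "\<tau> * 1 \<le> \<tau> * (k * (card H * (e / \<tau>)))"
        using \<tau> by (intro mult_left_mono) auto
      also have "\<dots> = k * card H * e" using \<tau> by simp
      finally show ?thesis unfolding \<tau>_def by simp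
    qed
    then show "\<exists>z. (\<forall>(a,b)\<in>H. a \<bullet> z \<le> b) \<and> norm (x - z) \<le> k * card H * e"
      using zZ unfolding Z_def by blast
  qed
qed

section \<open>Linear regularity of families of sets\<close>

text \<open>The inequalities of all \<open>D i\<close> form one system; nearness to every
  \<open>D i\<close> means small residuals, and Hoffman's bound returns a common point.\<close>

lemma polyhedra_linearly_regular:
  fixes D :: "'i \<Rightarrow> 'a::euclidean_space set"
  assumes fin: "finite E" and D: "\<And>i. i \<in> E \<Longrightarrow> polyhedron (D i)" and ne: "(\<Inter>i\<in>E. D i) \<noteq> {}"
  shows "\<exists>k\<ge>0. \<forall>x e. 0 \<le> e \<longrightarrow> (\<forall>i\<in>E. \<exists>y\<in>D i. norm (x - y) \<le> e) \<longrightarrow>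
           (\<exists>z\<in>(\<Inter>i\<in>E. D i). norm (x - z) \<le> k * e)"
proof -
  have "\<exists>H. finite H \<and> (\<forall>a b. (a, b) \<in> H \<longrightarrow> norm a = 1) \<and> D i = {x. \<forall>(a,b)\<in>H. a \<bullet> x \<le> b}"
    if "i \<in> E" for i
    by (rule polyhedron_normalized_inequalities[OF D[OF that]]) blast
  then have "\<forall>i\<in>E. \<exists>H. finite H \<and> (\<forall>a b. (a, b) \<in> H \<longrightarrow> norm a = 1) \<and>
      D i = {x. \<forall>(a,b)\<in>H. a \<bullet> x \<le> b}" by blast
  from bchoice[OF this] obtain h where h0: "\<forall>i\<in>E. finite (h i) \<and>
      (\<forall>a b. (a, b) \<in> h i \<longrightarrow> norm a = 1) \<and> D i = {x. \<forall>(a,b)\<in>h i. a \<bullet> x \<le> b}" by blast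
  have h: "\<And>i. i \<in> E \<Longrightarrow> finite (h i)"
      "\<And>i a b. i \<in> E \<Longrightarrow> (a, b) \<in> h i \<Longrightarrow> norm a = 1"
      "\<And>i. i \<in> E \<Longrightarrow> D i = {x. \<forall>(a,b)\<in>h i. a \<bullet> x \<le> b}"
    using h0 by blast+
  define H where "H = (\<Union>i\<in>E. h i)"
  have DH: "(\<Inter>i\<in>E. D i) = {x. \<forall>(a,b)\<in>H. a \<bullet> x \<le> b}"
    unfolding H_def using h(3) by blast
  have "finite H" using fin h(1) by (simp add: H_def)
  then obtain k where k: "k \<ge> 0" and k': "\<And>x e. 0 \<le> e \<Longrightarrow> (\<forall>(a,b)\<in>H. a \<bullet> x \<le> b + e) \<Longrightarrow>
           (\<exists>z. (\<forall>(a,b)\<in>H. a \<bullet> z \<le> b) \<and> norm (x - z) \<le> k * e)"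
    using hoffman_finite_inequalities[of H] ne unfolding DH by blast
  have "\<forall>(a,b)\<in>H. a \<bullet> x \<le> b + e"
    if "0 \<le> e" and y: "\<forall>i\<in>E. \<exists>y\<in>D i. norm (x - y) \<le> e" for x e
  proof safe
    fix a b assume "(a, b) \<in> H"
    then obtain i where i: "i \<in> E" "(a, b) \<in> h i" unfolding H_def by blast
    obtain y where y: "y \<in> D i" "norm (x - y) \<le> e" using y i by blast
    have "a \<bullet> y \<le> b" using y(1) h(3) i by blast
    moreover have "a \<bullet> (x - y) \<le> norm (x - y)"
      using norm_cauchy_schwarz[of a "x - y"] h(2) i by simp
    ultimately show "a \<bullet> x \<le> b + e" using y(2) by (simp add: inner_diff_right)
  qed
  then show ?thesis using k k' unfolding DH by (intro exI[of _ k]) blast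
qed

text \<open>Mixed polyhedral/relative-interior regularity: first project onto the polyhedron obtained by
  replacing each set with \<open>x0 \<in> rel_interior (D i)\<close> by its affine hull, then move towards
  \<open>x0\<close> just far enough to enter all these sets.\<close>

lemma boundedly_linearly_regular:
  fixes D :: "'i \<Rightarrow> 'a::euclidean_space set"
  assumes fin: "finite E" and clo: "\<And>i. i \<in> E \<Longrightarrow> closed (D i)" and cvx: "\<And>i. i \<in> E \<Longrightarrow> convex (D i)"
    and x0: "\<And>i. i \<in> E \<Longrightarrow> x0 \<in> D i"
    and qual: "\<And>i. i \<in> E \<Longrightarrow> polyhedron (D i) \<or> x0 \<in> rel_interior (D i)"
  shows "\<exists>k\<ge>0. \<forall>x e. norm (x - x0) \<le> R \<longrightarrow> 0 \<le> e \<longrightarrow> (\<forall>i\<in>E. \<exists>y\<in>D i. norm (x - y) \<le> e) \<longrightarrow>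
           (\<exists>z\<in>(\<Inter>i\<in>E. D i). norm (x - z) \<le> k * e)"
proof -
  define Q where "Q i = (if polyhedron (D i) then D i else affine hull D i)" for i
  have DQ: "D i \<subseteq> Q i" for i unfolding Q_def by (simp add: hull_subset)
  have Q: "polyhedron (Q i)" for i unfolding Q_def by (simp add: polyhedron_affine_hull)
  have x0Q: "x0 \<in> (\<Inter>i\<in>E. Q i)" using DQ x0 by blast
  have cQ: "convex (\<Inter>i\<in>E. Q i)" by (intro convex_INT polyhedron_imp_convex Q)
  obtain k where k: "k \<ge> 0" and k': "\<And>x e. 0 \<le> e \<Longrightarrow> (\<forall>i\<in>E. \<exists>y\<in>Q i. norm (x - y) \<le> e) \<Longrightarrow>
           (\<exists>z\<in>(\<Inter>i\<in>E. Q i). norm (x - z) \<le> k * e)"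
    using polyhedra_linearly_regular[OF fin, of Q] Q x0Q by blast
  \<comment> \<open>The radius enters through its reciprocal \<open>c\<close>, because a larger
    \<open>c\<close> is then a weaker demand, as merging over \<open>E\<close> requires.\<close>
  have "\<exists>c\<ge>0. \<forall>i\<in>E. \<forall>r>0. r * c \<le> 1 \<longrightarrow> polyhedron (D i) \<or> cball x0 r \<inter> affine hull D i \<subseteq> D i"
  proof (rule finite_uniform_bound[OF fin])
    fix i assume i: "i \<in> E"
    show "\<exists>c\<ge>0. \<forall>r>0. r * c \<le> 1 \<longrightarrow> polyhedron (D i) \<or> cball x0 r \<inter> affine hull D i \<subseteq> D i"
    proof (cases "polyhedron (D i)")
      case True then show ?thesis by auto
    next
      case False
      then have "x0 \<in> rel_interior (D i)" using qual i by blast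
      then obtain s where s: "s > 0" "cball x0 s \<inter> affine hull D i \<subseteq> D i"
        using mem_rel_interior_cball by blast
      have "cball x0 r \<subseteq> cball x0 s" if "r * (1 / s) \<le> 1" for r
        using s(1) that by (intro subset_cball) (simp add: field_simps)
      then show ?thesis using s by (intro exI[of _ "1 / s"]) auto
    qed
  next
    fix i and c c' :: real
    assume *: "\<forall>r>0. r * c \<le> 1 \<longrightarrow> polyhedron (D i) \<or> cball x0 r \<inter> affine hull D i \<subseteq> D i"
      and "c \<le> c'"
    then have "r * c \<le> 1" if "r > 0" "r * c' \<le> 1" for r
      using that by (smt (verit) mult_left_mono)
    then show "\<forall>r>0. r * c' \<le> 1 \<longrightarrow> polyhedron (D i) \<or> cball x0 r \<inter> affine hull D i \<subseteq> D i"
      using * by blast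
  qed
  then obtain c where c: "c \<ge> 0" "\<And>i r. i \<in> E \<Longrightarrow> r > 0 \<Longrightarrow> r * c \<le> 1 \<Longrightarrow>
      polyhedron (D i) \<or> cball x0 r \<inter> affine hull D i \<subseteq> D i" by blast
  define r where "r = 1 / (c + 1)"
  have r: "r > 0" "r * c \<le> 1" using c(1) by (auto simp: r_def)
  have ri: "cball x0 r \<inter> affine hull D i \<subseteq> D i" if "i \<in> E" "\<not> polyhedron (D i)" for i
    using c(2)[OF that(1) r] that(2) by blast
  define M where "M = (k + 1) / r"
  have M: "M \<ge> 0" using k r by (simp add: M_def)
  show ?thesis
  \<comment> \<open>The terms come from the move to \<open>p\<close>, from the move from
    \<open>p\<close> towards \<open>x0\<close>, of length at most
    \<open>M * e * (k * \<bar>R\<bar> + \<bar>R\<bar>)\<close>, and from the case where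
    \<open>x0\<close> itself is close enough.\<close>
  proof (intro exI[of _ "k + M * k * \<bar>R\<bar> + M * \<bar>R\<bar> + 1"] conjI allI impI)
    show "0 \<le> k + M * k * \<bar>R\<bar> + M * \<bar>R\<bar> + 1" using k M by simp
    fix x and e :: real
    assume xR: "norm (x - x0) \<le> R" and e: "0 \<le> e" and y: "\<forall>i\<in>E. \<exists>y\<in>D i. norm (x - y) \<le> e"
    show "\<exists>z\<in>(\<Inter>i\<in>E. D i). norm (x - z) \<le> (k + M * k * \<bar>R\<bar> + M * \<bar>R\<bar> + 1) * e"
    proof (cases "norm (x - x0) \<le> e")
      case True
      have "1 * e \<le> (k + M * k * \<bar>R\<bar> + M * \<bar>R\<bar> + 1) * e"
        using k M e by (intro mult_right_mono) simp_all
      then show ?thesis using True x0 by (intro bexI[of _ x0]) auto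
    next
      case False
      then have eR: "e \<le> \<bar>R\<bar>" using xR by linarith
      have "\<forall>i\<in>E. \<exists>y\<in>Q i. norm (x - y) \<le> e" using y DQ by blast
      then obtain p where p: "p \<in> (\<Inter>i\<in>E. Q i)" "norm (x - p) \<le> k * e" using k'[OF e] by blast
      \<comment> \<open>Each \<open>D i\<close> has a point within \<open>e\<close> of
        \<open>x\<close>, and \<open>p\<close> is within \<open>k * e\<close> of \<open>x\<close>,
        so \<open>\<delta>\<close> bounds the distance from \<open>p\<close> to every
        \<open>D i\<close>.\<close>
      define \<delta> where "\<delta> = (k + 1) * e"
      have \<delta>: "\<delta> \<ge> 0" using k e by (simp add: \<delta>_def)
      define w where "w = (r / (r + \<delta>)) *\<^sub>R p + (\<delta> / (r + \<delta>)) *\<^sub>R x0"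
      have conv1: "r / (r + \<delta>) + \<delta> / (r + \<delta>) = 1" "r / (r + \<delta>) \<ge> 0" "\<delta> / (r + \<delta>) \<ge> 0" "r + \<delta> > 0"
        using r \<delta> by (auto simp: add_divide_distrib[symmetric])
      have wQ: "w \<in> (\<Inter>i\<in>E. Q i)"
        unfolding w_def using conv1 by (intro convexD[OF cQ p(1) x0Q]) auto
      have wD: "w \<in> D i" if i: "i \<in> E" for i
      proof (cases "polyhedron (D i)")
        case True then show ?thesis using wQ i by (auto simp: Q_def)
      next
        case np: False
        obtain s where s: "s \<in> D i" "norm (x - s) \<le> e" using y i by blast
        have "norm (p - s) \<le> norm (x - p) + norm (x - s)"
          using dist_triangle3[of p s x] by (simp add: dist_norm)
        then have ps: "norm (p - s) \<le> \<delta>" using p(2) s(2) by (simp add: \<delta>_def algebra_simps)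
        have pA: "p \<in> affine hull D i" using p(1) i np by (auto simp: Q_def split: if_splits)
        have sA: "s \<in> affine hull D i" "x0 \<in> affine hull D i"
          using s x0 i by (auto intro: hull_inc)
        show ?thesis
        proof (cases "\<delta> = 0")
          case True
          then show ?thesis using ps s(1) r by (simp add: w_def)
        next
          case False
          \<comment> \<open>\<open>v\<close> is chosen so that \<open>w\<close> is a convex
            combination of \<open>s\<close> and \<open>v\<close>, both in \<open>D i\<close>:
            \<open>p - s\<close> is a direction of the affine hull and is rescaled to length at most
            \<open>r\<close>.\<close>
          define v where "v = x0 + (r / \<delta>) *\<^sub>R (p - s)"
          have "v \<in> affine hull D i" unfolding v_def
            by (intro mem_affine_3_minus affine_affine_hull sA pA)
          moreover have "norm ((r / \<delta>) *\<^sub>R (p - s)) \<le> r"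
          proof -
            have "norm ((r / \<delta>) *\<^sub>R (p - s)) = (r / \<delta>) * norm (p - s)"
              using r \<delta> by (simp del: scaleR_right_diff_distrib)
            also have "\<dots> \<le> (r / \<delta>) * \<delta>" using ps r \<delta> by (intro mult_left_mono) auto
            finally show ?thesis using False by simp
          qed
          then have "v \<in> cball x0 r"
            by (simp add: v_def dist_norm del: scaleR_right_diff_distrib norm_scaleR)
          ultimately have "v \<in> D i" using ri[OF i np] by blast
          then have "(r / (r + \<delta>)) *\<^sub>R s + (\<delta> / (r + \<delta>)) *\<^sub>R v \<in> D i"
            using conv1 s(1) by (intro convexD[OF cvx[OF i]]) auto
          moreover have "(r / (r + \<delta>)) *\<^sub>R s + (\<delta> / (r + \<delta>)) *\<^sub>R v = w"
          proof -
            have "(\<delta> / (r + \<delta>)) *\<^sub>R v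
                = (\<delta> / (r + \<delta>)) *\<^sub>R x0 + (\<delta> / (r + \<delta>) * (r / \<delta>)) *\<^sub>R (p - s)"
              by (simp only: v_def scaleR_add_right scaleR_scaleR)
            also have "\<delta> / (r + \<delta>) * (r / \<delta>) = r / (r + \<delta>)" using False by simp
            finally show ?thesis by (simp add: w_def scaleR_right_diff_distrib)
          qed
          ultimately show ?thesis by simp
        qed
      qed
      have pw: "p - w = (\<delta> / (r + \<delta>)) *\<^sub>R (p - x0)"
      proof -
        have "r / (r + \<delta>) = 1 - \<delta> / (r + \<delta>)" using conv1(1) by linarith
        then show ?thesis unfolding w_def
          by (simp only: scaleR_left_diff_distrib scaleR_right_diff_distrib scaleR_one) simp
      qed
      have "norm (p - x0) \<le> norm (x - p) + norm (x - x0)"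
        using dist_triangle3[of p x0 x] by (simp add: dist_norm)
      also have "\<dots> \<le> k * \<bar>R\<bar> + \<bar>R\<bar>"
        using p(2) xR eR k mult_left_mono[OF eR k] by linarith
      finally have px0: "norm (p - x0) \<le> k * \<bar>R\<bar> + \<bar>R\<bar>" .
      have "norm (p - w) = (\<delta> / (r + \<delta>)) * norm (p - x0)"
        unfolding pw norm_scaleR using conv1(3) by (simp only: abs_of_nonneg)
      also have "\<dots> \<le> (\<delta> / r) * (k * \<bar>R\<bar> + \<bar>R\<bar>)"
        using px0 r \<delta> k by (intro mult_mono divide_left_mono mult_pos_pos conv1 divide_nonneg_pos) simp_all
      also have "\<delta> / r = M * e" by (simp add: \<delta>_def M_def)
      also have "M * e * (k * \<bar>R\<bar> + \<bar>R\<bar>) = (M * k * \<bar>R\<bar> + M * \<bar>R\<bar>) * e" by algebra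
      finally have "norm (p - w) \<le> (M * k * \<bar>R\<bar> + M * \<bar>R\<bar>) * e" .
      moreover have "norm (x - w) \<le> norm (x - p) + norm (p - w)"
        using dist_triangle[of x w p] by (simp add: dist_norm)
      ultimately have "norm (x - w) \<le> (k + M * k * \<bar>R\<bar> + M * \<bar>R\<bar>) * e"
        using p(2) by (simp add: algebra_simps)
      also have "\<dots> \<le> (k + M * k * \<bar>R\<bar> + M * \<bar>R\<bar> + 1) * e"
        using k M e by (intro mult_right_mono) simp_all
      finally show ?thesis using wD by blast
    qed
  qed
qed

section \<open>Relaxed projectors and fixed points of the operators\<close>

lemma closest_point_eqI:
  fixes S :: "'a::euclidean_space set"
  assumes "closed S" "convex S" "p \<in> S" and p: "\<And>y. y \<in> S \<Longrightarrow> (x - p) \<bullet> (y - p) \<le> 0"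
  shows "closest_point S x = p"
proof -
  define q where "q = closest_point S x"
  have "q \<in> S" unfolding q_def using assms by (intro closest_point_in_set) auto
  then have "(x - p) \<bullet> (q - p) \<le> 0" by (rule p)
  moreover have "(x - q) \<bullet> (p - q) \<le> 0"
    unfolding q_def using assms by (intro closest_point_dot)
  ultimately have "(q - p) \<bullet> (q - p) \<le> 0"
    by (simp add: inner_diff_left inner_diff_right inner_commute)
  then have "q - p = 0" by (metis inner_gt_zero_iff not_less)
  then show ?thesis by (simp add: q_def)
qed

lemma closest_point_monotone:
  fixes S :: "'a::euclidean_space set"
  assumes "closed S" "convex S" "S \<noteq> {}"
  shows "0 \<le> (closest_point S x - closest_point S y) \<bullet>
    ((x - closest_point S x) - (y - closest_point S y))"
proof -
  have "closest_point S x \<in> S" "closest_point S y \<in> S"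
    using assms by (auto intro: closest_point_in_set)
  then have "(x - closest_point S x) \<bullet> (closest_point S y - closest_point S x) \<le> 0"
    "(y - closest_point S y) \<bullet> (closest_point S x - closest_point S y) \<le> 0"
    using assms by (auto intro: closest_point_dot)
  then show ?thesis
    by (simp add: inner_diff_left inner_diff_right inner_commute)
qed

text \<open>With \<open>x - y\<close> split into the projection part \<open>e\<close> and the
  residual part \<open>g\<close>, monotonicity gives \<open>0 \<le> e \<bullet> g\<close>, and
  expanding the square leaves the gain \<open>lam * (2 - lam)\<close>. It vanishes at
  \<open>lam = 2\<close>, which is what makes reflections the hard case.\<close>

lemma relaxed_projector_diff_le:
  fixes S :: "'a::euclidean_space set"
  assumes S: "closed S" "convex S" "S \<noteq> {}" and "0 \<le> lam"
  shows "(norm (relaxed_projector S lam x - relaxed_projector S lam y))\<^sup>2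
    \<le> (norm (x - y))\<^sup>2
       - lam * (2 - lam) * (norm ((x - closest_point S x) - (y - closest_point S y)))\<^sup>2"
proof -
  define e where "e = closest_point S x - closest_point S y"
  define g where "g = (x - closest_point S x) - (y - closest_point S y)"
  have eg: "0 \<le> e \<bullet> g" unfolding e_def g_def by (rule closest_point_monotone[OF S])
  have d: "x - y = e + g" by (simp add: e_def g_def)
  have r: "relaxed_projector S lam x - relaxed_projector S lam y = (e + g) - lam *\<^sub>R g"
    by (simp add: relaxed_projector_def e_def g_def algebra_simps)
  have "(norm ((e + g) - lam *\<^sub>R g))\<^sup>2
      = (norm (e + g))\<^sup>2 - 2 * lam * (e \<bullet> g) - lam * (2 - lam) * (norm g)\<^sup>2"
    unfolding power2_norm_eq_inner
    by (simp add: inner_diff_left inner_diff_right inner_add_left inner_add_right inner_commute algebra_simps)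
  moreover have "0 \<le> 2 * lam * (e \<bullet> g)" using eg assms(4) by simp
  ultimately show ?thesis unfolding r d g_def[symmetric] by linarith
qed

lemma relaxed_projector_nonexpansive:
  fixes S :: "'a::euclidean_space set"
  assumes "closed S" "convex S" "S \<noteq> {}" "0 \<le> lam" "lam \<le> 2"
  shows "norm (relaxed_projector S lam x - relaxed_projector S lam y) \<le> norm (x - y)"
proof -
  have "0 \<le> lam * (2 - lam) * (norm ((x - closest_point S x) - (y - closest_point S y)))\<^sup>2"
    using assms by simp
  then have "(norm (relaxed_projector S lam x - relaxed_projector S lam y))\<^sup>2 \<le> (norm (x - y))\<^sup>2"
    using relaxed_projector_diff_le[OF assms(1-4), of x y] by linarith
  then show ?thesis by (rule power2_le_imp_le) simp
qed

lemma relaxed_projector_mem: "closed S \<Longrightarrow> p \<in> S \<Longrightarrow> relaxed_projector S lam p = p"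
  by (simp add: relaxed_projector_def closest_point_self algebra_simps)

lemma relaxed_projector_minus:
  "x - relaxed_projector S lam x = lam *\<^sub>R (x - closest_point S x)"
  by (simp add: relaxed_projector_def algebra_simps)

lemma gDR_operator_eq:
  "gDR_operator \<alpha> A lam B mu x
     = x + \<alpha> *\<^sub>R (relaxed_projector B mu (relaxed_projector A lam x) - x)"
  by (simp add: gDR_operator_def algebra_simps)

lemma norm_minus_gDR_operator:
  assumes "0 < \<alpha>"
  shows "norm (x - gDR_operator \<alpha> A lam B mu x)
    = \<alpha> * norm (relaxed_projector B mu (relaxed_projector A lam x) - x)"
proof -
  have "x - gDR_operator \<alpha> A lam B mu x
      = (-\<alpha>) *\<^sub>R (relaxed_projector B mu (relaxed_projector A lam x) - x)"
    by (simp add: gDR_operator_eq)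
  then show ?thesis using assms by simp
qed

lemma gDR_operator_fixed_iff:
  "\<alpha> \<noteq> 0 \<Longrightarrow> gDR_operator \<alpha> A lam B mu x = x
     \<longleftrightarrow> relaxed_projector B mu (relaxed_projector A lam x) = x"
  by (simp add: gDR_operator_eq)

section \<open>Two relaxed projections in succession and the averagedness estimate\<close>

lemma double_relaxation_displacement:
  "relaxed_projector B mu (relaxed_projector A lam x) - x
    = - (lam *\<^sub>R (x - closest_point A x)
       + mu *\<^sub>R (relaxed_projector A lam x - closest_point B (relaxed_projector A lam x)))"
  by (simp add: relaxed_projector_def algebra_simps)

lemma double_relaxation_quasi_nonexpansive:
  fixes A B :: "'a::euclidean_space set" and x :: 'a
  assumes A: "closed A" "convex A" and B: "closed B" "convex B" and p: "p \<in> A \<inter> B"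
    and lam: "0 \<le> lam" and mu: "0 \<le> mu"
  defines "y \<equiv> relaxed_projector A lam x"
  shows "(norm (relaxed_projector B mu y - p))\<^sup>2
    \<le> (norm (x - p))\<^sup>2 - lam * (2 - lam) * (norm (x - closest_point A x))\<^sup>2
        - mu * (2 - mu) * (norm (y - closest_point B y))\<^sup>2"
proof -
  have "A \<noteq> {}" "B \<noteq> {}" "p \<in> A" "p \<in> B" using p by auto
  then show ?thesis
    using relaxed_projector_diff_le[OF A _ lam, of x p] relaxed_projector_diff_le[OF B _ mu, of y p]
      relaxed_projector_mem[OF A(1), of p lam] relaxed_projector_mem[OF B(1), of p mu]
      closest_point_self[of p A] closest_point_self[of p B]
    by (simp add: y_def)
qed

text \<open>This is the origin of \<open>beta_hat\<close>. The gains of the two relaxations are the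
  squared step lengths \<open>X\<close> and \<open>Z\<close> divided by
  \<open>u = lam / (2 - lam)\<close> and \<open>v = mu / (2 - mu)\<close>. The displacement is at
  most \<open>X + Z\<close>, and weighted Cauchy-Schwarz bounds its square by \<open>u + v\<close>
  times the total gain.\<close>

lemma double_relaxation_averaged:
  fixes A B :: "'a::euclidean_space set"
  assumes A: "closed A" "convex A" and B: "closed B" "convex B" and p: "p \<in> A \<inter> B"
    and lam: "0 < lam" "lam < 2" and mu: "0 < mu" "mu < 2"
  shows "(norm (relaxed_projector B mu (relaxed_projector A lam x) - p))\<^sup>2
    \<le> (norm (x - p))\<^sup>2
       - beta_hat lam mu * (norm (relaxed_projector B mu (relaxed_projector A lam x) - x))\<^sup>2"
proof -
  define y where "y = relaxed_projector A lam x"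
  define X where "X = lam * norm (x - closest_point A x)"
  define Z where "Z = mu * norm (y - closest_point B y)"
  define u where "u = lam / (2 - lam)"
  define v where "v = mu / (2 - mu)"
  have uv: "u > 0" "v > 0" using lam mu by (auto simp: u_def v_def)
  have b: "beta_hat lam mu = inverse (u + v)" using lam mu by (simp add: beta_hat_def u_def v_def)
  have e1: "lam * (2 - lam) * (norm (x - closest_point A x))\<^sup>2 = X\<^sup>2 / u"
    using lam by (simp add: X_def u_def power2_eq_square field_simps)
  have e2: "mu * (2 - mu) * (norm (y - closest_point B y))\<^sup>2 = Z\<^sup>2 / v"
    using mu by (simp add: Z_def v_def power2_eq_square field_simps)
  have "norm (relaxed_projector B mu y - x) \<le> X + Z"
    unfolding y_def double_relaxation_displacement norm_minus_cancel X_def Z_def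
    using lam mu norm_triangle_ineq[of "lam *\<^sub>R (x - closest_point A x)"
      "mu *\<^sub>R (relaxed_projector A lam x - closest_point B (relaxed_projector A lam x))"]
    by (simp only: norm_scaleR abs_of_pos)
  then have "(norm (relaxed_projector B mu y - x))\<^sup>2 \<le> (X + Z)\<^sup>2" by (intro power_mono) auto
  also have "(X + Z)\<^sup>2 \<le> (u + v) * (X\<^sup>2 / u + Z\<^sup>2 / v)"
  proof -
    have "(u + v) * (X\<^sup>2 / u + Z\<^sup>2 / v) - (X + Z)\<^sup>2 = (v * X - u * Z)\<^sup>2 / (u * v)"
      using uv by (simp add: divide_simps) (simp add: power2_eq_square algebra_simps)
    also have "\<dots> \<ge> 0" using uv by simp
    finally show ?thesis by simp
  qed
  finally have "beta_hat lam mu * (norm (relaxed_projector B mu y - x))\<^sup>2 \<le> X\<^sup>2 / u + Z\<^sup>2 / v"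
    unfolding b using uv by (simp add: field_simps)
  then show ?thesis
    using double_relaxation_quasi_nonexpansive[OF A B p, of lam mu x] lam mu e1 e2
    by (simp add: y_def)
qed

text \<open>The expansion of the squared norm of an affine combination holds for every real
  \<open>\<alpha>\<close>, also beyond 1. It turns the gain \<open>b\<close> of \<open>r\<close>
  into \<open>\<alpha> * (1 + b - \<alpha>)\<close>, which is positive throughout the assumed range
  of \<open>\<alpha>\<close>.\<close>

lemma relaxation_of_quasi_nonexpansive:
  fixes x r p :: "'a::real_inner"
  assumes q: "(norm (r - p))\<^sup>2 \<le> (norm (x - p))\<^sup>2 - b * (norm (r - x))\<^sup>2"
    and \<alpha>: "0 < \<alpha>" "\<alpha> < 1 + b"
  defines "y \<equiv> x + \<alpha> *\<^sub>R (r - x)"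
  shows "norm (y - p) \<le> norm (x - p)"
    and "(norm (x - y))\<^sup>2 \<le> \<alpha> / (1 + b - \<alpha>) * ((norm (x - p))\<^sup>2 - (norm (y - p))\<^sup>2)"
proof -
  have id: "(norm (y - p))\<^sup>2 = (1 - \<alpha>) * (norm (x - p))\<^sup>2 + \<alpha> * (norm (r - p))\<^sup>2
      - \<alpha> * (1 - \<alpha>) * (norm (r - x))\<^sup>2"
    unfolding y_def power2_norm_eq_inner
    by (simp add: inner_diff_left inner_diff_right inner_add_left inner_add_right inner_commute algebra_simps)
  have "\<alpha> * (norm (r - p))\<^sup>2 \<le> \<alpha> * ((norm (x - p))\<^sup>2 - b * (norm (r - x))\<^sup>2)"
    using q \<alpha> by (intro mult_left_mono) auto
  then have main: "(norm (y - p))\<^sup>2 \<le> (norm (x - p))\<^sup>2 - \<alpha> * (1 + b - \<alpha>) * (norm (r - x))\<^sup>2"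
    unfolding id by (simp add: algebra_simps)
  moreover have "0 \<le> \<alpha> * (1 + b - \<alpha>) * (norm (r - x))\<^sup>2" using \<alpha> by simp
  ultimately have "(norm (y - p))\<^sup>2 \<le> (norm (x - p))\<^sup>2" by linarith
  then show "norm (y - p) \<le> norm (x - p)" by (rule power2_le_imp_le) simp
  have "x - y = (-\<alpha>) *\<^sub>R (r - x)" by (simp add: y_def)
  then have "(norm (x - y))\<^sup>2 = \<alpha>\<^sup>2 * (norm (r - x))\<^sup>2"
    by (simp only: norm_scaleR) (simp add: power_mult_distrib)
  also have "\<dots> = \<alpha> / (1 + b - \<alpha>) * (\<alpha> * (1 + b - \<alpha>) * (norm (r - x))\<^sup>2)"
    using \<alpha> by (simp add: power2_eq_square)
  also have "\<dots> \<le> \<alpha> / (1 + b - \<alpha>) * ((norm (x - p))\<^sup>2 - (norm (y - p))\<^sup>2)"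
    using main \<alpha> by (intro mult_left_mono) auto
  finally show "(norm (x - y))\<^sup>2 \<le> \<alpha> / (1 + b - \<alpha>) * ((norm (x - p))\<^sup>2 - (norm (y - p))\<^sup>2)" .
qed

lemma gDR_operator_fejer:
  fixes A B :: "'a::euclidean_space set"
  assumes A: "closed A" "convex A" and B: "closed B" "convex B" and ne: "A \<noteq> {}" "B \<noteq> {}"
    and lam: "0 < lam" "lam \<le> 2" and mu: "0 < mu" "mu \<le> 2"
    and \<alpha>: "0 < \<alpha>" "\<alpha> < 1 + beta_hat lam mu"
    and p: "p \<in> A \<inter> B \<or> lam = 2 \<and> mu = 2 \<and> gDR_operator \<alpha> A lam B mu p = p"
  shows "norm (gDR_operator \<alpha> A lam B mu x - p) \<le> norm (x - p)"
    and "(norm (x - gDR_operator \<alpha> A lam B mu x))\<^sup>2 \<le> \<alpha> / (1 + beta_hat lam mu - \<alpha>) *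
           ((norm (x - p))\<^sup>2 - (norm (gDR_operator \<alpha> A lam B mu x - p))\<^sup>2)"
proof -
  define R where "R = (\<lambda>x. relaxed_projector B mu (relaxed_projector A lam x))"
  have "(norm (R x - p))\<^sup>2 \<le> (norm (x - p))\<^sup>2 - beta_hat lam mu * (norm (R x - x))\<^sup>2"
  proof (cases "lam = 2 \<or> mu = 2")
    case True
    have "R p = p"
    proof (cases "p \<in> A \<inter> B")
      case True
      then show ?thesis using A(1) B(1) by (simp add: R_def relaxed_projector_mem)
    next
      case False
      then show ?thesis using p \<alpha>(1) gDR_operator_fixed_iff[of \<alpha> A lam B mu p] by (auto simp: R_def)
    qed
    have "norm (R x - R p) \<le> norm (relaxed_projector A lam x - relaxed_projector A lam p)"
      unfolding R_def using B ne mu by (intro relaxed_projector_nonexpansive) auto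
    also have "\<dots> \<le> norm (x - p)"
      using A ne lam by (intro relaxed_projector_nonexpansive) auto
    finally have "(norm (R x - p))\<^sup>2 \<le> (norm (x - p))\<^sup>2"
      using \<open>R p = p\<close> by (intro power_mono) auto
    then show ?thesis using True by (simp add: beta_hat_def)
  next
    case False
    then show ?thesis unfolding R_def using double_relaxation_averaged[OF A B] p lam mu by simp
  qed
  from relaxation_of_quasi_nonexpansive[OF this \<alpha>]
  show "norm (gDR_operator \<alpha> A lam B mu x - p) \<le> norm (x - p)"
    and "(norm (x - gDR_operator \<alpha> A lam B mu x))\<^sup>2 \<le> \<alpha> / (1 + beta_hat lam mu - \<alpha>) *
           ((norm (x - p))\<^sup>2 - (norm (gDR_operator \<alpha> A lam B mu x - p))\<^sup>2)"
    by (simp_all add: gDR_operator_eq R_def)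
qed

section \<open>Fixed points of two composed reflections\<close>

text \<open>When \<open>z\<close> is a common point, \<open>u\<close> belongs to this cone iff
  \<open>u\<close> is normal to \<open>A\<close> at \<open>z\<close> and \<open>- u\<close> is
  normal to \<open>B\<close> at \<open>z\<close>. Since the cone does not depend on
  \<open>z\<close>, the fixed point set becomes a Minkowski sum.\<close>

definition difference_polar :: "'a::euclidean_space set \<Rightarrow> 'a set \<Rightarrow> 'a set" where
  "difference_polar A B = {u. \<forall>a\<in>A. \<forall>b\<in>B. u \<bullet> (a - b) \<le> 0}"

lemma convex_difference_polar: "convex (difference_polar A B)"
proof -
  have "difference_polar A B = (\<Inter>a\<in>A. \<Inter>b\<in>B. {u. (a - b) \<bullet> u \<le> 0})"
    by (auto simp: difference_polar_def inner_commute)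
  then show ?thesis by (auto intro!: convex_INT convex_halfspace_le)
qed

lemma reflections_displacement:
  "relaxed_projector B 2 (relaxed_projector A 2 x) - x
    = 2 *\<^sub>R (closest_point B (2 *\<^sub>R closest_point A x - x) - closest_point A x)"
proof -
  have "relaxed_projector A 2 x = 2 *\<^sub>R closest_point A x - x"
    by (simp add: relaxed_projector_def algebra_simps scaleR_2)
  then show ?thesis by (simp add: relaxed_projector_def algebra_simps scaleR_2)
qed

lemma reflections_fixed_iff:
  assumes "\<alpha> \<noteq> 0"
  shows "gDR_operator \<alpha> A 2 B 2 x = x
    \<longleftrightarrow> closest_point B (2 *\<^sub>R closest_point A x - x) = closest_point A x"
proof -
  have "gDR_operator \<alpha> A 2 B 2 x = x
      \<longleftrightarrow> relaxed_projector B 2 (relaxed_projector A 2 x) - x = 0"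
    using gDR_operator_fixed_iff[OF assms, of A 2 B 2 x] by simp
  then show ?thesis unfolding reflections_displacement by simp
qed

lemma closest_point_add_difference_polar:
  assumes A: "closed A" "convex A" and B: "closed B" "convex B"
    and z: "z \<in> A \<inter> B" and u: "u \<in> difference_polar A B"
  shows "closest_point A (z + u) = z" "closest_point B (z - u) = z"
proof -
  show "closest_point A (z + u) = z"
    using A z u by (intro closest_point_eqI) (auto simp: difference_polar_def)
  show "closest_point B (z - u) = z"
  proof (rule closest_point_eqI[OF B])
    show "z \<in> B" using z by simp
    fix y assume "y \<in> B"
    then have "u \<bullet> (z - y) \<le> 0" using z u by (auto simp: difference_polar_def)
    then show "(z - u - z) \<bullet> (y - z) \<le> 0" by (simp add: inner_diff_right)
  qed
qed

lemma Fix_reflections: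
  assumes A: "closed A" "convex A" and B: "closed B" "convex B" and ne: "A \<noteq> {}" "B \<noteq> {}"
    and \<alpha>: "\<alpha> \<noteq> 0"
  shows "Fix (gDR_operator \<alpha> A 2 B 2) = (A \<inter> B) + difference_polar A B"
proof (intro set_eqI iffI)
  fix x assume "x \<in> Fix (gDR_operator \<alpha> A 2 B 2)"
  then have fx: "closest_point B (2 *\<^sub>R closest_point A x - x) = closest_point A x"
    using reflections_fixed_iff[OF \<alpha>] by (auto simp: Fix_def)
  define a where "a = closest_point A x"
  have aA: "a \<in> A" unfolding a_def using A ne by (intro closest_point_in_set)
  have aB: "a \<in> B" using closest_point_in_set[OF B(1) ne(2), of "2 *\<^sub>R a - x"] fx by (simp add: a_def)
  \<comment> \<open>Both variational inequalities hold at the common projection \<open>a\<close>,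
    with residual \<open>x - a\<close> for \<open>A\<close> and its negative for \<open>B\<close>;
    adding them leaves \<open>a' - b'\<close>.\<close>
  have "(x - a) \<bullet> (a' - b') \<le> 0" if "a' \<in> A" "b' \<in> B" for a' b'
  proof -
    have "(x - a) \<bullet> (a' - a) \<le> 0"
      unfolding a_def using A that by (intro closest_point_dot)
    moreover have "(2 *\<^sub>R a - x - a) \<bullet> (b' - a) \<le> 0"
      using closest_point_dot[OF B(2,1) that(2), of "2 *\<^sub>R a - x"] fx by (simp add: a_def)
    ultimately show ?thesis by (simp add: algebra_simps scaleR_2)
  qed
  then have "x - a \<in> difference_polar A B" by (simp add: difference_polar_def)
  then have "a + (x - a) \<in> (A \<inter> B) + difference_polar A B" using aA aB by (intro set_plus_intro) auto
  then show "x \<in> (A \<inter> B) + difference_polar A B" by simp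
next
  fix x assume "x \<in> (A \<inter> B) + difference_polar A B"
  then obtain z u where zu: "x = z + u" "z \<in> A \<inter> B" "u \<in> difference_polar A B"
    by (auto elim: set_plus_elim)
  have "2 *\<^sub>R z - (z + u) = z - u" by (simp add: scaleR_2)
  then have "gDR_operator \<alpha> A 2 B 2 x = x"
    using closest_point_add_difference_polar[OF A B zu(2,3)] zu(1)
      reflections_fixed_iff[OF \<alpha>, of A B x] by metis
  then show "x \<in> Fix (gDR_operator \<alpha> A 2 B 2)" by (simp add: Fix_def)
qed

lemma closed_Fix_gDR_operator:
  fixes A B :: "'a::euclidean_space set"
  assumes "closed A" "convex A" "closed B" "convex B" "A \<noteq> {}" "B \<noteq> {}"
  shows "closed (Fix (gDR_operator \<alpha> A lam B mu))"
proof -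
  have "continuous_on UNIV (closest_point A)" "continuous_on UNIV (closest_point B)"
    using assms by (auto intro: continuous_on_closest_point)
  then have "continuous_on UNIV (gDR_operator \<alpha> A lam B mu)"
    unfolding gDR_operator_def relaxed_projector_def
    by (auto intro!: continuous_intros continuous_on_compose2[of UNIV "closest_point B"])
  then have "closed {x. gDR_operator \<alpha> A lam B mu x = x}"
    by (intro closed_Collect_eq continuous_on_id)
  then show ?thesis by (simp add: Fix_def)
qed

text \<open>A hyperplane with normal \<open>u\<close> through \<open>x0\<close> contains the affine
  hull as soon as it contains \<open>A \<union> B\<close>, so orthogonality can be tested on the
  sets themselves from one base point.\<close>

lemma orthogonal_comp_affine_differences:
  assumes "x0 \<in> A \<union> B"
  shows "(minkowski_diff (affine hull (A \<union> B)) (affine hull (A \<union> B)))\<^sup>\<bottom>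
    = {u. \<forall>w\<in>A \<union> B. u \<bullet> (w - x0) = 0}"
proof (intro set_eqI iffI)
  fix u assume u: "u \<in> (minkowski_diff (affine hull (A \<union> B)) (affine hull (A \<union> B)))\<^sup>\<bottom>"
  have "(w - x0) \<bullet> u = 0" if "w \<in> A \<union> B" for w
  proof -
    have "w - x0 \<in> minkowski_diff (affine hull (A \<union> B)) (affine hull (A \<union> B))"
      using that assms unfolding minkowski_diff_def by (blast intro: hull_inc)
    then show ?thesis using u by (auto simp: orthogonal_comp_def orthogonal_def)
  qed
  then show "u \<in> {u. \<forall>w\<in>A \<union> B. u \<bullet> (w - x0) = 0}" by (auto simp: inner_commute)
next
  fix u assume u: "u \<in> {u. \<forall>w\<in>A \<union> B. u \<bullet> (w - x0) = 0}"
  have "affine hull (A \<union> B) \<subseteq> {w. u \<bullet> w = u \<bullet> x0}"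
    using u by (intro hull_minimal affine_hyperplane) (auto simp: inner_diff_right)
  then show "u \<in> (minkowski_diff (affine hull (A \<union> B)) (affine hull (A \<union> B)))\<^sup>\<bottom>"
    by (auto simp: orthogonal_comp_def orthogonal_def minkowski_diff_def inner_diff_left
        inner_commute[of _ u] subset_iff inner_diff_right)
qed

section \<open>Error bounds\<close>

text \<open>Here \<open>D\<close> is a distance to be bounded, \<open>e\<close> a displacement and
  \<open>q\<close> a residual known only through its square. Squaring the last assumption yields a
  multiple of \<open>e * D\<close>, and one factor \<open>D\<close> cancels. The summand 1 in the
  constant gives \<open>e < D\<close> under the contrary assumption, so that the square of
  \<open>e\<close> is at most \<open>e * D\<close>.\<close>

lemma linear_bound_of_quadratic:
  fixes D q e :: real
  assumes "0 \<le> D" "0 \<le> e" "0 \<le> c" and q: "q\<^sup>2 \<le> c * (e * D)" and D: "D \<le> a * q + b * e"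
  shows "D \<le> (2 * a\<^sup>2 * c + 2 * b\<^sup>2 + 1) * e"
proof (rule ccontr)
  assume neg: "\<not> D \<le> (2 * a\<^sup>2 * c + 2 * b\<^sup>2 + 1) * e"
  have "0 \<le> (2 * a\<^sup>2 * c + 2 * b\<^sup>2) * e" using assms by simp
  then have eD: "e < D" using neg by (simp add: algebra_simps)
  have "D\<^sup>2 \<le> (a * q + b * e)\<^sup>2" using D assms(1) by (intro power_mono)
  also have "\<dots> \<le> 2 * a\<^sup>2 * q\<^sup>2 + 2 * b\<^sup>2 * e\<^sup>2"
    using zero_le_power2[of "a * q - b * e"] by (simp add: power2_eq_square algebra_simps)
  also have "\<dots> \<le> 2 * a\<^sup>2 * (c * (e * D)) + 2 * b\<^sup>2 * (e * D)"
    using q eD assms(2) by (intro add_mono mult_left_mono) (auto simp: power2_eq_square mult_left_mono)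
  also have "\<dots> = ((2 * a\<^sup>2 * c + 2 * b\<^sup>2) * e) * D" by (simp add: algebra_simps)
  finally have "D \<le> (2 * a\<^sup>2 * c + 2 * b\<^sup>2) * e"
    using eD assms(2) by (simp add: power2_eq_square mult_le_cancel_right)
  then show False using neg assms(2) by (simp add: algebra_simps)
qed

text \<open>One of the factors \<open>lam * (2 - lam)\<close> and \<open>mu * (2 - mu)\<close> is
  positive, so the square of one residual is bounded by displacement times distance. The other
  residual follows from the triangle inequality, since the displacement combines both relaxation
  moves.\<close>

lemma gDR_error_bound_underrelaxed:
  fixes A B :: "'a::euclidean_space set"
  assumes A: "closed A" "convex A" and B: "closed B" "convex B" and x0: "x0 \<in> A \<inter> B"
    and lam: "0 < lam" "lam \<le> 2" and mu: "0 < mu" "mu \<le> 2" and lt: "min lam mu < 2"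
    and \<alpha>: "0 < \<alpha>"
    and reg: "\<And>R. \<exists>k\<ge>0. \<forall>x e. norm (x - x0) \<le> R \<longrightarrow> 0 \<le> e \<longrightarrow> (\<exists>y\<in>A. norm (x - y) \<le> e) \<longrightarrow>
        (\<exists>y\<in>B. norm (x - y) \<le> e) \<longrightarrow> (\<exists>z\<in>A \<inter> B. norm (x - z) \<le> k * e)"
  shows "\<exists>k\<ge>0. \<forall>x. norm (x - x0) \<le> R \<longrightarrow>
           (\<exists>z\<in>A \<inter> B. norm (x - z) \<le> k * norm (x - gDR_operator \<alpha> A lam B mu x))"
proof -
  have ne: "A \<noteq> {}" "B \<noteq> {}" "A \<inter> B \<noteq> {}" using x0 by auto
  obtain k where k: "k \<ge> 0" and k': "\<And>x e. norm (x - x0) \<le> R \<Longrightarrow> 0 \<le> e \<Longrightarrow> (\<exists>y\<in>A. norm (x - y) \<le> e) \<Longrightarrow>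
        (\<exists>y\<in>B. norm (x - y) \<le> e) \<Longrightarrow> (\<exists>z\<in>A \<inter> B. norm (x - z) \<le> k * e)"
    using reg[of R] by blast
  have "\<exists>c\<ge>0. \<forall>x. norm (x - x0) \<le> R \<longrightarrow> norm (x - closest_point (A \<inter> B) x)
          \<le> c * norm (relaxed_projector B mu (relaxed_projector A lam x) - x)"
  proof -
    define y where "y x = relaxed_projector A lam x" for x
    define a where "a x = norm (x - closest_point A x)" for x
    define b where "b x = norm (y x - closest_point B (y x))" for x
    define D where "D x = norm (x - closest_point (A \<inter> B) x)" for x
    define e where "e x = norm (relaxed_projector B mu (y x) - x)" for x
    have clo: "closed (A \<inter> B)" using A B by auto
    \<comment> \<open>The distance to \<open>p\<close> drops by at most \<open>e x\<close>, so its
      square drops by at most \<open>2 * (e x * D x)\<close>; both gains are paid from this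
      drop.\<close>
    have sq: "lam * (2 - lam) * (a x)\<^sup>2 \<le> 2 * (e x * D x)"
      "mu * (2 - mu) * (b x)\<^sup>2 \<le> 2 * (e x * D x)" for x
    proof -
      define p where "p = closest_point (A \<inter> B) x"
      have p: "p \<in> A \<inter> B" unfolding p_def using clo ne by (intro closest_point_in_set)
      have m: "(norm (relaxed_projector B mu (y x) - p))\<^sup>2
          \<le> (D x)\<^sup>2 - lam * (2 - lam) * (a x)\<^sup>2 - mu * (2 - mu) * (b x)\<^sup>2"
        using double_relaxation_quasi_nonexpansive[OF A B p, of lam mu x] lam mu
        by (simp add: D_def a_def b_def y_def p_def)
      have "D x \<le> norm (relaxed_projector B mu (y x) - p) + e x"
        using dist_triangle3[of x p "relaxed_projector B mu (y x)"]
        by (simp add: D_def e_def p_def dist_norm)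
      moreover have "e x \<ge> 0" "D x \<ge> 0" by (auto simp: e_def D_def)
      ultimately have "(D x)\<^sup>2 \<le> D x * (norm (relaxed_projector B mu (y x) - p) + e x)"
        by (simp add: power2_eq_square mult_left_mono)
      moreover have "2 * (D x * norm (relaxed_projector B mu (y x) - p))
          \<le> (D x)\<^sup>2 + (norm (relaxed_projector B mu (y x) - p))\<^sup>2"
        using sum_squares_bound[of "D x" "norm (relaxed_projector B mu (y x) - p)"] by simp
      ultimately have "(D x)\<^sup>2 - 2 * (e x * D x) \<le> (norm (relaxed_projector B mu (y x) - p))\<^sup>2"
        by (simp add: algebra_simps)
      moreover have "0 \<le> lam * (2 - lam) * (a x)\<^sup>2" "0 \<le> mu * (2 - mu) * (b x)\<^sup>2"
        using lam mu by auto
      ultimately show "lam * (2 - lam) * (a x)\<^sup>2 \<le> 2 * (e x * D x)"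
        "mu * (2 - mu) * (b x)\<^sup>2 \<le> 2 * (e x * D x)" using m by linarith+
    qed
    have tri: "lam * a x \<le> e x + mu * b x" "mu * b x \<le> e x + lam * a x" for x
    proof -
      define v where "v = lam *\<^sub>R (x - closest_point A x)"
      define w where "w = mu *\<^sub>R (y x - closest_point B (y x))"
      have "relaxed_projector B mu (y x) - x = - (v + w)"
        unfolding v_def w_def y_def by (rule double_relaxation_displacement)
      then have ex: "e x = norm (v + w)" by (simp only: e_def norm_minus_cancel)
      have n: "norm v = lam * a x" "norm w = mu * b x"
        using lam mu by (auto simp: v_def w_def a_def b_def)
      show "lam * a x \<le> e x + mu * b x" "mu * b x \<le> e x + lam * a x"
        using norm_triangle_ineq4[of "v + w" w] norm_triangle_ineq4[of "v + w" v] ex n by auto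
    qed
    have nn: "0 \<le> a x" "0 \<le> b x" "0 \<le> D x" "0 \<le> e x" for x
      by (auto simp: a_def b_def D_def e_def)
    \<comment> \<open>\<open>closest_point B (y x)\<close> is reached from \<open>x\<close> via
      \<open>y x\<close> at cost \<open>lam * a x + b x\<close> with \<open>lam \<le> 2\<close>, so
      \<open>3 * a x + b x\<close> dominates the distances to both sets.\<close>
    have Dk: "D x \<le> k * (3 * a x + b x)" if x: "norm (x - x0) \<le> R" for x
    proof -
      have pA: "closest_point A x \<in> A" and pB: "closest_point B (y x) \<in> B"
        using A B ne by (auto intro: closest_point_in_set)
      have "norm (x - closest_point A x) \<le> 3 * a x + b x" using nn[of x] by (simp add: a_def)
      moreover have "norm (x - y x) = lam * a x"
        using lam by (simp add: y_def relaxed_projector_minus a_def)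
      then have "norm (x - closest_point B (y x)) \<le> lam * a x + b x"
        using dist_triangle[of x "closest_point B (y x)" "y x"] by (simp add: b_def dist_norm)
      moreover have "lam * a x \<le> 2 * a x" using lam nn by (intro mult_right_mono) auto
      ultimately have "norm (x - closest_point A x) \<le> 3 * a x + b x"
        "norm (x - closest_point B (y x)) \<le> 3 * a x + b x" using nn[of x] by linarith+
      then have "\<exists>z\<in>A \<inter> B. norm (x - z) \<le> k * (3 * a x + b x)"
        using nn[of x] pA pB by (intro k'[OF x]) auto
      then obtain z where z: "z \<in> A \<inter> B" "norm (x - z) \<le> k * (3 * a x + b x)" by blast
      have "D x \<le> norm (x - z)"
        using closest_point_le[OF clo z(1), of x] by (simp add: D_def dist_norm)
      then show ?thesis using z(2) by linarith
    qed
    show ?thesis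
    proof (cases "lam < 2")
      case True
      then have c: "lam * (2 - lam) > 0" using lam by simp
      define c where "c = 2 / (lam * (2 - lam))"
      have c0: "c \<ge> 0" using c by (simp add: c_def)
      define C where "C = 2 * (k * (3 + lam / mu))\<^sup>2 * c + 2 * (k / mu)\<^sup>2 + 1"
      have "D x \<le> C * e x" if x: "norm (x - x0) \<le> R" for x
        unfolding C_def
      proof (rule linear_bound_of_quadratic[OF nn(3,4) c0])
        show "(a x)\<^sup>2 \<le> c * (e x * D x)" using sq(1)[of x] c by (simp add: c_def field_simps)
        have "b x \<le> (e x + lam * a x) / mu" using tri(2)[of x] mu by (simp add: field_simps)
        then have "k * (3 * a x + b x) \<le> k * (3 * a x + (e x + lam * a x) / mu)"
          using k by (intro mult_left_mono) auto
        also have "\<dots> = k * (3 + lam / mu) * a x + k / mu * e x"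
          using mu by (simp add: field_simps)
        finally show "D x \<le> k * (3 + lam / mu) * a x + k / mu * e x" using Dk[OF x] by linarith
      qed
      moreover have "C \<ge> 0" using c0 by (simp add: C_def)
      ultimately show ?thesis unfolding D_def e_def y_def by blast
    next
      case False
      then have "mu < 2" using lt lam by linarith
      then have c: "mu * (2 - mu) > 0" using mu by simp
      define c where "c = 2 / (mu * (2 - mu))"
      have c0: "c \<ge> 0" using c by (simp add: c_def)
      define C where "C = 2 * (k * (3 * mu / lam + 1))\<^sup>2 * c + 2 * (3 * k / lam)\<^sup>2 + 1"
      have "D x \<le> C * e x" if x: "norm (x - x0) \<le> R" for x
        unfolding C_def
      proof (rule linear_bound_of_quadratic[OF nn(3,4) c0])
        show "(b x)\<^sup>2 \<le> c * (e x * D x)" using sq(2)[of x] c by (simp add: c_def field_simps)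
        have "a x \<le> (e x + mu * b x) / lam" using tri(1)[of x] lam by (simp add: field_simps)
        then have "k * (3 * a x + b x) \<le> k * (3 * ((e x + mu * b x) / lam) + b x)"
          using k by (intro mult_left_mono add_mono) auto
        also have "\<dots> = k * (3 * mu / lam + 1) * b x + 3 * k / lam * e x"
          using lam by (simp add: field_simps)
        finally show "D x \<le> k * (3 * mu / lam + 1) * b x + 3 * k / lam * e x"
          using Dk[OF x] by linarith
      qed
      moreover have "C \<ge> 0" using c0 by (simp add: C_def)
      ultimately show ?thesis unfolding D_def e_def y_def by blast
    qed
  qed
  then obtain c where c: "c \<ge> 0" "\<And>x. norm (x - x0) \<le> R \<Longrightarrow> norm (x - closest_point (A \<inter> B) x)
          \<le> c * norm (relaxed_projector B mu (relaxed_projector A lam x) - x)" by blast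
  have mem: "closest_point (A \<inter> B) x \<in> A \<inter> B" for x
    using A B ne by (intro closest_point_in_set) auto
  show ?thesis
  proof (intro exI[of _ "c / \<alpha>"] conjI allI impI)
    show "0 \<le> c / \<alpha>" using c \<alpha> by simp
    fix x assume x: "norm (x - x0) \<le> R"
    show "\<exists>z\<in>A \<inter> B. norm (x - z) \<le> c / \<alpha> * norm (x - gDR_operator \<alpha> A lam B mu x)"
      using c(2)[OF x] mem[of x] \<alpha>
      by (intro bexI[of _ "closest_point (A \<inter> B) x"]) (auto simp: norm_minus_gDR_operator)
  qed
qed

section \<open>Two reflections whose relative interiors meet\<close>

lemma norm_reflections_displacement:
  assumes "0 < \<alpha>"
  shows "norm (x - gDR_operator \<alpha> A 2 B 2 x)
    = 2 * \<alpha> * norm (closest_point A x - closest_point B (2 *\<^sub>R closest_point A x - x))"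
  unfolding norm_minus_gDR_operator[OF assms] reflections_displacement
  by (simp add: norm_minus_commute)

lemma closest_point_norm_le:
  fixes A :: "'a::euclidean_space set"
  assumes "closed A" "convex A" "x0 \<in> A"
  shows "norm (closest_point A x - x0) \<le> norm (x - x0)"
  using closest_point_lipschitz[of A x x0] closest_point_self[of x0 A] assms
  by (auto simp: dist_norm)

lemma closest_point_reflection_norm_le:
  fixes A B :: "'a::euclidean_space set"
  assumes A: "closed A" "convex A" and B: "closed B" "convex B" and x0: "x0 \<in> A \<inter> B"
  shows "norm (closest_point B (2 *\<^sub>R closest_point A x - x) - x0) \<le> norm (x - x0)"
proof -
  have "norm (closest_point B (2 *\<^sub>R closest_point A x - x) - x0)
      \<le> norm (2 *\<^sub>R closest_point A x - x - x0)"
    using B x0 by (intro closest_point_norm_le) auto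
  also have "2 *\<^sub>R closest_point A x - x - x0 = relaxed_projector A 2 x - relaxed_projector A 2 x0"
    using relaxed_projector_mem[OF A(1), of x0 2] x0
    by (simp add: relaxed_projector_def algebra_simps scaleR_2)
  also have "norm \<dots> \<le> norm (x - x0)"
    using A x0 by (intro relaxed_projector_nonexpansive) auto
  finally show ?thesis .
qed

lemma rel_interior_extend_beyond:
  fixes x0 :: "'a::euclidean_space"
  assumes "x0 \<in> rel_interior S" "w \<in> S"
  shows "\<exists>\<eta>>0. x0 - \<eta> *\<^sub>R (w - x0) \<in> S"
proof -
  obtain e where e: "e > 0" "cball x0 e \<inter> affine hull S \<subseteq> S" "x0 \<in> S"
    using assms(1) mem_rel_interior_cball by blast
  define \<eta> where "\<eta> = e / (norm (w - x0) + 1)"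
  have \<eta>: "\<eta> > 0" using e(1) by (simp add: \<eta>_def add_nonneg_pos)
  have "\<eta> * norm (w - x0) \<le> e"
    using e(1) by (simp add: \<eta>_def divide_simps add_nonneg_pos)
  then have "x0 - \<eta> *\<^sub>R (w - x0) \<in> cball x0 e"
    using \<eta> by (simp add: dist_norm del: scaleR_right_diff_distrib)
  moreover have "x0 - \<eta> *\<^sub>R (w - x0) \<in> affine hull S"
    using assms(2) e(3) by (intro mem_affine_3_minus2 affine_affine_hull hull_inc)
  ultimately show ?thesis using e(2) \<eta> by blast
qed

text \<open>A small displacement puts \<open>x - a x\<close> approximately into the polar of
  \<open>A - B\<close>. Testing with a point and with its prolongation beyond \<open>x0\<close>
  makes the inequality two-sided, so \<open>x - a x\<close> is close to the orthogonal complement,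
  while \<open>a x\<close> is close to both sets.\<close>

lemma gDR_error_bound_reflections_rel_interior:
  fixes A B :: "'a::euclidean_space set"
  assumes A: "closed A" "convex A" and B: "closed B" "convex B"
    and x0: "x0 \<in> rel_interior A \<inter> rel_interior B" and \<alpha>: "0 < \<alpha>"
  shows "\<exists>k\<ge>0. \<forall>x. norm (x - x0) \<le> R \<longrightarrow>
           (\<exists>z\<in>(A \<inter> B) + (minkowski_diff (affine hull (A \<union> B)) (affine hull (A \<union> B)))\<^sup>\<bottom>.
             norm (x - z) \<le> k * norm (x - gDR_operator \<alpha> A 2 B 2 x))"
proof (cases "R \<ge> 0")
  case False
  then show ?thesis by (intro exI[of _ 0]) (auto dest: order_trans[OF norm_ge_zero])
next
  case R: True
  have xAB: "x0 \<in> A" "x0 \<in> B" using x0 rel_interior_subset by blast+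
  then have ne: "A \<noteq> {}" "B \<noteq> {}" by auto
  define a where "a x = closest_point A x" for x
  define b where "b x = closest_point B (2 *\<^sub>R a x - x)" for x
  define e where "e x = norm (a x - b x)" for x
  have aA: "a x \<in> A" and bB: "b x \<in> B" for x
    using A B ne by (auto simp: a_def b_def intro: closest_point_in_set)
  have a0: "norm (a x - x0) \<le> norm (x - x0)" for x
    unfolding a_def by (rule closest_point_norm_le[OF A xAB(1)])
  have ua: "norm (x - a x) \<le> norm (x - x0)" for x
    using closest_point_le[OF A(1) xAB(1), of x] by (simp add: a_def dist_norm)
  have b0: "norm (b x - x0) \<le> norm (x - x0)" for x
    unfolding b_def a_def using closest_point_reflection_norm_le[OF A B] xAB by blast
  have key: "(x - a x) \<bullet> (a' - b') \<le> e x * (2 * R + norm (b' - x0))"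
    if x: "norm (x - x0) \<le> R" and a': "a' \<in> A" and b': "b' \<in> B" for x a' b'
  proof -
    have 1: "(x - a x) \<bullet> (a' - a x) \<le> 0"
      unfolding a_def using A a' by (intro closest_point_dot)
    have 2: "(2 *\<^sub>R a x - x - b x) \<bullet> (b' - b x) \<le> 0"
      unfolding b_def using B b' by (intro closest_point_dot)
    \<comment> \<open>With \<open>a x = b x\<close> only the two variational terms would remain;
      every other term carries the factor \<open>a x - b x\<close>.\<close>
    have "(x - a x) \<bullet> (a' - b') = (x - a x) \<bullet> (a' - a x) + (2 *\<^sub>R a x - x - b x) \<bullet> (b' - b x)
        + (x - a x) \<bullet> (a x - b x) - (a x - b x) \<bullet> (b' - b x)"
      by (simp add: inner_diff_left inner_diff_right inner_commute scaleR_2 inner_add_left inner_add_right)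
    moreover have "(x - a x) \<bullet> (a x - b x) \<le> norm (x - a x) * e x"
      unfolding e_def by (rule norm_cauchy_schwarz)
    moreover have "- ((a x - b x) \<bullet> (b' - b x)) \<le> e x * norm (b' - b x)"
      using Cauchy_Schwarz_ineq2[of "a x - b x" "b' - b x"] unfolding e_def by linarith
    moreover have "norm (x - a x) * e x + e x * norm (b' - b x)
        = e x * (norm (x - a x) + norm (b' - b x))" by (simp add: algebra_simps)
    moreover have "e x * (norm (x - a x) + norm (b' - b x)) \<le> e x * (2 * R + norm (b' - x0))"
      using ua[of x] b0[of x] x dist_triangle2[of b' "b x" x0]
      by (intro mult_left_mono) (auto simp: e_def dist_norm)
    ultimately show ?thesis using 1 2 by linarith
  qed
  define V where "V = (\<lambda>w. w - x0) ` (A \<union> B)"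
  \<comment> \<open>The basis is drawn from \<open>V\<close> itself, so each of its vectors is
    \<open>w - x0\<close> with \<open>w\<close> in \<open>A\<close> or \<open>B\<close> and can be
    prolonged beyond \<open>x0\<close>; its finiteness makes the constants uniform.\<close>
  obtain G where G: "G \<subseteq> V" "independent G" "V \<subseteq> span G"
    using maximal_independent_subset by blast
  have finG: "finite G" using G(2) independent_imp_finite by blast
  have "\<exists>k\<ge>0. \<forall>g\<in>G. \<forall>x. norm (x - x0) \<le> R \<longrightarrow> \<bar>(x - a x) \<bullet> g\<bar> \<le> k * e x"
  proof (rule finite_uniform_bound[OF finG])
    fix g assume "g \<in> G"
    then obtain w where w: "w \<in> A \<union> B" "g = w - x0" using G(1) unfolding V_def by blast
    show "\<exists>k\<ge>0. \<forall>x. norm (x - x0) \<le> R \<longrightarrow> \<bar>(x - a x) \<bullet> g\<bar> \<le> k * e x"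
    \<comment> \<open>For \<open>w\<close> in \<open>A\<close>, \<open>b' = x0\<close> is kept and
      \<open>a'\<close> is \<open>w\<close> or its prolongation; for \<open>w\<close> in
      \<open>B\<close> the roles are exchanged.\<close>
    proof (cases "w \<in> A")
      case True
      then obtain \<eta> where \<eta>: "\<eta> > 0" "x0 - \<eta> *\<^sub>R g \<in> A"
        using rel_interior_extend_beyond[of x0 A w] x0 w(2) by blast
      have "\<bar>(x - a x) \<bullet> g\<bar> \<le> (2 * R + 2 * R / \<eta>) * e x" if x: "norm (x - x0) \<le> R" for x
      proof -
        have "(x - a x) \<bullet> g \<le> e x * (2 * R)"
          using key[OF x True xAB(2)] by (simp add: w(2))
        moreover have "\<eta> * - ((x - a x) \<bullet> g) \<le> e x * (2 * R)"
          using key[OF x \<eta>(2) xAB(2)] by simp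
        then have "- ((x - a x) \<bullet> g) \<le> e x * (2 * R / \<eta>)"
          using \<eta>(1) by (simp add: field_simps)
        moreover have "0 \<le> e x * (2 * R)" "0 \<le> e x * (2 * R / \<eta>)" using R \<eta> by (auto simp: e_def)
        moreover have "(2 * R + 2 * R / \<eta>) * e x = e x * (2 * R) + e x * (2 * R / \<eta>)"
          by (simp only: mult.commute[of _ "e x"] distrib_left)
        ultimately show ?thesis by linarith
      qed
      then show ?thesis using R \<eta>(1) by (intro exI[of _ "2 * R + 2 * R / \<eta>"]) auto
    next
      case False
      then have wB: "w \<in> B" using w by blast
      then obtain \<eta> where \<eta>: "\<eta> > 0" "x0 - \<eta> *\<^sub>R g \<in> B"
        using rel_interior_extend_beyond[of x0 B w] x0 w(2) by blast
      have "\<bar>(x - a x) \<bullet> g\<bar> \<le> ((2 * R + norm g) + (2 * R / \<eta> + norm g)) * e x"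
        if x: "norm (x - x0) \<le> R" for x
      proof -
        have "(x - a x) \<bullet> (x0 - w) \<le> e x * (2 * R + norm g)"
          using key[OF x xAB(1) wB] by (simp add: w(2))
        then have "- ((x - a x) \<bullet> g) \<le> e x * (2 * R + norm g)"
          by (simp add: w(2) inner_diff_right)
        moreover have "\<eta> * ((x - a x) \<bullet> g) \<le> e x * (2 * R + \<eta> * norm g)"
          using key[OF x xAB(1) \<eta>(2)] \<eta>(1) by simp
        then have "(x - a x) \<bullet> g \<le> e x * (2 * R / \<eta> + norm g)"
          using \<eta>(1) by (simp add: field_simps)
        moreover have "0 \<le> e x * (2 * R + norm g)" "0 \<le> e x * (2 * R / \<eta> + norm g)"
          using R \<eta> by (auto simp: e_def)
        moreover have "((2 * R + norm g) + (2 * R / \<eta> + norm g)) * e x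
            = e x * (2 * R + norm g) + e x * (2 * R / \<eta> + norm g)"
          by (simp only: mult.commute[of _ "e x"] distrib_left)
        ultimately show ?thesis by linarith
      qed
      then show ?thesis using R \<eta>(1)
        by (intro exI[of _ "(2 * R + norm g) + (2 * R / \<eta> + norm g)"]) auto
    qed
  next
    fix g :: 'a and k k' :: real
    assume *: "\<forall>x. norm (x - x0) \<le> R \<longrightarrow> \<bar>(x - a x) \<bullet> g\<bar> \<le> k * e x" "k \<le> k'"
    have "k * e x \<le> k' * e x" for x using *(2) by (intro mult_right_mono) (auto simp: e_def)
    then show "\<forall>x. norm (x - x0) \<le> R \<longrightarrow> \<bar>(x - a x) \<bullet> g\<bar> \<le> k' * e x"
      using *(1) order_trans by blast
  qed
  then obtain k1 where k1: "k1 \<ge> 0"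
    "\<And>g x. g \<in> G \<Longrightarrow> norm (x - x0) \<le> R \<Longrightarrow> \<bar>(x - a x) \<bullet> g\<bar> \<le> k1 * e x" by blast
  \<comment> \<open>Each equation \<open>g \<bullet> z = 0\<close> becomes two inequalities, so
    Hoffman's bound measures the distance to the orthogonal complement of
    \<open>span G\<close>.\<close>
  define H where "H = (\<lambda>g. (g, 0::real)) ` (G \<union> uminus ` G)"
  have "finite H" using finG by (simp add: H_def)
  moreover have "0 \<in> {z::'a. \<forall>(g,c)\<in>H. g \<bullet> z \<le> c}" by (auto simp: H_def)
  ultimately obtain k2 where k2: "k2 \<ge> 0" "\<And>x e. 0 \<le> e \<Longrightarrow> (\<forall>(g,c)\<in>H. g \<bullet> x \<le> c + e) \<Longrightarrow>
           (\<exists>z. (\<forall>(g,c)\<in>H. g \<bullet> z \<le> c) \<and> norm (x - z) \<le> k2 * e)"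
    using hoffman_finite_inequalities[of H] by blast
  have "\<exists>k\<ge>0. \<forall>x e. norm (x - x0) \<le> R \<longrightarrow> 0 \<le> e \<longrightarrow> (\<forall>S\<in>{A, B}. \<exists>y\<in>S. norm (x - y) \<le> e) \<longrightarrow>
           (\<exists>z\<in>(\<Inter>S\<in>{A, B}. S). norm (x - z) \<le> k * e)"
    using A B x0 xAB by (intro boundedly_linearly_regular) auto
  then obtain k3 where k3: "k3 \<ge> 0" "\<And>x e. norm (x - x0) \<le> R \<Longrightarrow> 0 \<le> e \<Longrightarrow>
      (\<forall>S\<in>{A, B}. \<exists>y\<in>S. norm (x - y) \<le> e) \<Longrightarrow> (\<exists>z\<in>(\<Inter>S\<in>{A, B}. S). norm (x - z) \<le> k3 * e)"
    by blast
  have main: "\<exists>z\<in>(A \<inter> B) + (minkowski_diff (affine hull (A \<union> B)) (affine hull (A \<union> B)))\<^sup>\<bottom>.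
             norm (x - z) \<le> (k3 + k2 * k1) * e x" if x: "norm (x - x0) \<le> R" for x
  proof -
    have e0: "e x \<ge> 0" by (simp add: e_def)
    have "\<exists>y\<in>A. norm (a x - y) \<le> e x" using aA[of x] e0 by (intro bexI[of _ "a x"]) auto
    moreover have "\<exists>y\<in>B. norm (a x - y) \<le> e x"
      using bB[of x] by (intro bexI[of _ "b x"]) (auto simp: e_def)
    ultimately have "\<forall>S\<in>{A, B}. \<exists>y\<in>S. norm (a x - y) \<le> e x" by blast
    moreover have "norm (a x - x0) \<le> R" using a0[of x] x by linarith
    ultimately obtain z where z: "z \<in> A \<inter> B" "norm (a x - z) \<le> k3 * e x"
      using k3(2)[of "a x" "e x"] e0 by auto
    have "\<forall>(g,c)\<in>H. g \<bullet> (x - a x) \<le> c + k1 * e x"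
      using k1(2)[OF _ x] by (fastforce simp: H_def inner_commute)
    then obtain u where u: "\<forall>(g,c)\<in>H. g \<bullet> u \<le> c" "norm (x - a x - u) \<le> k2 * (k1 * e x)"
      using k2(2)[of "k1 * e x" "x - a x"] k1(1) e0 by auto
    have uG: "u \<bullet> g = 0" if "g \<in> G" for g
    proof -
      have "(g, 0) \<in> H" "(- g, 0) \<in> H" using that by (auto simp: H_def)
      then have "g \<bullet> u \<le> 0" "(- g) \<bullet> u \<le> 0" using u(1) by blast+
      then show ?thesis by (simp add: inner_commute)
    qed
    have "orthogonal u v" if "v \<in> V" for v
    proof (rule orthogonal_to_span)
      show "v \<in> span G" using G(3) that by blast
      show "orthogonal u g" if "g \<in> G" for g using uG[OF that] by (simp add: orthogonal_def)
    qed
    then have "u \<in> (minkowski_diff (affine hull (A \<union> B)) (affine hull (A \<union> B)))\<^sup>\<bottom>"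
      unfolding orthogonal_comp_affine_differences[OF UnI1[OF xAB(1)]]
      by (auto simp: orthogonal_def V_def)
    then have "z + u \<in> (A \<inter> B) + (minkowski_diff (affine hull (A \<union> B)) (affine hull (A \<union> B)))\<^sup>\<bottom>"
      using z(1) by (intro set_plus_intro)
    moreover have "norm (x - (z + u)) \<le> (k3 + k2 * k1) * e x"
    proof -
      have "norm (x - (z + u)) \<le> norm (a x - z) + norm (x - a x - u)"
        using norm_triangle_ineq[of "a x - z" "x - a x - u"] by (simp add: algebra_simps)
      then show ?thesis using z(2) u(2) by (simp add: algebra_simps)
    qed
    ultimately show ?thesis by blast
  qed
  show ?thesis
  proof (intro exI[of _ "(k3 + k2 * k1) / (2 * \<alpha>)"] conjI allI impI)
    show "0 \<le> (k3 + k2 * k1) / (2 * \<alpha>)" using k1 k2 k3 \<alpha> by simp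
    fix x assume x: "norm (x - x0) \<le> R"
    have "(k3 + k2 * k1) / (2 * \<alpha>) * norm (x - gDR_operator \<alpha> A 2 B 2 x) = (k3 + k2 * k1) * e x"
      unfolding norm_reflections_displacement[OF \<alpha>] e_def a_def b_def using \<alpha> by simp
    then show "\<exists>z\<in>(A \<inter> B) + (minkowski_diff (affine hull (A \<union> B)) (affine hull (A \<union> B)))\<^sup>\<bottom>.
        norm (x - z) \<le> (k3 + k2 * k1) / (2 * \<alpha>) * norm (x - gDR_operator \<alpha> A 2 B 2 x)"
      using main[OF x] by simp
  qed
qed

text \<open>At a fixed point the displacement is zero, so the error bound already places the point
  in the sum; the other inclusion holds because the orthogonal complement is contained in the
  polar.\<close>

lemma Fix_reflections_rel_interior:
  fixes A B :: "'a::euclidean_space set"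
  assumes A: "closed A" "convex A" and B: "closed B" "convex B"
    and ri: "rel_interior A \<inter> rel_interior B \<noteq> {}" and \<alpha>: "0 < \<alpha>"
  shows "(A \<inter> B) + (minkowski_diff (affine hull (A \<union> B)) (affine hull (A \<union> B)))\<^sup>\<bottom>
    = Fix (gDR_operator \<alpha> A 2 B 2)" (is "?Y = _")
proof
  obtain x0 where x0: "x0 \<in> rel_interior A \<inter> rel_interior B" using ri by blast
  have xAB: "x0 \<in> A" "x0 \<in> B" using x0 rel_interior_subset by blast+
  then have ne: "A \<noteq> {}" "B \<noteq> {}" by auto
  show "Fix (gDR_operator \<alpha> A 2 B 2) \<subseteq> ?Y"
  proof
    fix x assume "x \<in> Fix (gDR_operator \<alpha> A 2 B 2)"
    then have fx: "gDR_operator \<alpha> A 2 B 2 x = x" by (simp add: Fix_def)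
    show "x \<in> ?Y"
      using gDR_error_bound_reflections_rel_interior[OF A B x0 \<alpha>, of "norm (x - x0)"] fx by fastforce
  qed
  have "(minkowski_diff (affine hull (A \<union> B)) (affine hull (A \<union> B)))\<^sup>\<bottom> \<subseteq> difference_polar A B"
    unfolding orthogonal_comp_affine_differences[OF UnI1[OF xAB(1)]] difference_polar_def
    by (auto simp: inner_diff_right)
  then show "?Y \<subseteq> Fix (gDR_operator \<alpha> A 2 B 2)"
    using Fix_reflections[OF A B ne, of \<alpha>] \<alpha> by (simp add: set_plus_mono2)
qed

text \<open>Since every vector of \<open>N\<close> is orthogonal to \<open>S - x0\<close>, both summands of a point of
  \<open>S + N\<close> are affine functions of it, so no general theorem on sums of polyhedra is needed.\<close>

lemma polyhedron_orthogonal_sum: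
  fixes S N :: "'a::euclidean_space set"
  assumes S: "polyhedron S" and N: "polyhedron N"
    and orth: "\<And>u z. u \<in> N \<Longrightarrow> z \<in> S \<Longrightarrow> u \<bullet> (z - x0) = 0"
  shows "polyhedron (S + N)"
proof -
  define W where "W = span ((\<lambda>z. z - x0) ` S)"
  have "subspace W" by (simp add: W_def)
  then obtain B where B: "B \<subseteq> W" "pairwise orthogonal B" "\<And>x. x \<in> B \<Longrightarrow> norm x = 1"
      "independent B" "span B = W"
    by (rule orthonormal_basis_subspace) blast
  have finB: "finite B" using B(4) independent_imp_finite by blast
  \<comment> \<open>This is the orthogonal projector onto \<open>W\<close> in orthonormal
    coordinates. Shifted by \<open>x0\<close>, it recovers the summand in \<open>S\<close>, and the
    remainder is the summand in \<open>N\<close>.\<close>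
  define f where "f x = (\<Sum>b\<in>B. (x \<bullet> b) *\<^sub>R b)" for x
  have lin: "linear f"
    by (rule linearI)
      (simp_all add: f_def inner_add_left scaleR_add_left sum.distrib scaleR_sum_right)
  have fS: "f (z - x0) = z - x0" if "z \<in> S" for z
    unfolding f_def using that B finB
    by (intro orthonormal_basis_expand) (auto simp: W_def span_base)
  have fN: "f u = 0" if "u \<in> N" for u
  proof -
    have "orthogonal u w" if "w \<in> W" for w
      using that orth[OF \<open>u \<in> N\<close>] unfolding W_def
      by (elim orthogonal_to_span) (auto simp: orthogonal_def)
    then show ?thesis using B(1) by (auto simp: f_def orthogonal_def intro!: sum.neutral)
  qed
  have "S + N = {x. f x + (x0 - f x0) \<in> S} \<inter> {x. (x - f x) + (f x0 - x0) \<in> N}"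
  proof (intro set_eqI iffI)
    fix x assume "x \<in> S + N"
    then obtain z u where zu: "x = z + u" "z \<in> S" "u \<in> N" by (auto elim: set_plus_elim)
    have "f z = z - x0 + f x0" using fS[OF zu(2)] by (simp add: linear_diff[OF lin] algebra_simps)
    then have "f x = z - x0 + f x0" using fN[OF zu(3)] by (simp add: zu(1) linear_add[OF lin])
    then show "x \<in> {x. f x + (x0 - f x0) \<in> S} \<inter> {x. (x - f x) + (f x0 - x0) \<in> N}"
      using zu by (simp add: algebra_simps)
  next
    fix x assume "x \<in> {x. f x + (x0 - f x0) \<in> S} \<inter> {x. (x - f x) + (f x0 - x0) \<in> N}"
    then have "(f x + (x0 - f x0)) + ((x - f x) + (f x0 - x0)) \<in> S + N"
      by (intro set_plus_intro) auto
    then show "x \<in> S + N" by simp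
  qed
  moreover have "linear (\<lambda>x. x - f x)" using lin by (intro linear_compose_sub linear_ident)
  ultimately show ?thesis
    using S N lin by (simp add: polyhedron_linear_preimage)
qed

section \<open>Normal cones of polyhedra and the polyhedral error bound\<close>

text \<open>Converse of \<open>normal_vector_mem_convex_cone_hull_active\<close>, for any set
  \<open>K\<close> of inequalities tight at \<open>a\<close>, complete or not: further inequalities
  may be tight at some points of a graph piece.\<close>

lemma active_cone_subset_normal_cone:
  fixes H :: "('a::euclidean_space \<times> real) set"
  assumes K: "K \<subseteq> H" and a: "\<forall>p\<in>K. fst p \<bullet> a = snd p"
    and v: "v \<in> convex_cone hull (fst ` K)" and y: "\<forall>(c,d)\<in>H. c \<bullet> y \<le> d"
  shows "v \<bullet> (y - a) \<le> 0"
proof -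
  have "convex_cone hull (fst ` K) \<subseteq> {v. v \<bullet> (y - a) \<le> 0}"
  proof (rule hull_minimal)
    show "fst ` K \<subseteq> {v. v \<bullet> (y - a) \<le> 0}"
    proof clarify
      fix c d assume "(c, d) \<in> K"
      then have "c \<bullet> y \<le> d" "c \<bullet> a = d" using K y a by force+
      then show "fst (c, d) \<bullet> (y - a) \<le> 0" by (simp add: inner_diff_right)
    qed
    show "convex_cone {v. v \<bullet> (y - a) \<le> 0}"
      by (auto simp: convex_cone_iff inner_add_left mult_nonneg_nonpos)
  qed
  then show ?thesis using v by blast
qed

lemma polyhedron_normal_cone:
  fixes S :: "'a::euclidean_space set"
  assumes "polyhedron S" "z \<in> S"
  shows "polyhedron {u. \<forall>y\<in>S. u \<bullet> (y - z) \<le> 0}"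
proof -
  obtain H where H: "finite H" "S = {x. \<forall>(a,b)\<in>H. a \<bullet> x \<le> b}"
    by (rule polyhedron_normalized_inequalities[OF assms(1)]) blast
  define K where "K = {p \<in> H. fst p \<bullet> z = snd p}"
  have z: "\<forall>(a,b)\<in>H. a \<bullet> z \<le> b" using assms(2) H(2) by blast
  have "{u. \<forall>y\<in>S. u \<bullet> (y - z) \<le> 0} = convex_cone hull (fst ` K)"
  proof (intro equalityI subsetI)
    fix u assume "u \<in> {u. \<forall>y\<in>S. u \<bullet> (y - z) \<le> 0}"
    then show "u \<in> convex_cone hull (fst ` K)"
      unfolding K_def H(2) by (intro normal_vector_mem_convex_cone_hull_active[OF H(1) z]) blast
  next
    fix u assume u: "u \<in> convex_cone hull (fst ` K)"
    have "u \<bullet> (y - z) \<le> 0" if "y \<in> S" for y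
      using that H(2) u by (intro active_cone_subset_normal_cone[of K H]) (auto simp: K_def)
    then show "u \<in> {u. \<forall>y\<in>S. u \<bullet> (y - z) \<le> 0}" by blast
  qed
  then show ?thesis using H(1) by (simp add: polyhedron_convex_cone_hull K_def)
qed

text \<open>The polar of \<open>A - B\<close> is the normal cone of \<open>A\<close> at
  \<open>z\<close> intersected with the negative of that of \<open>B\<close>. It is orthogonal to
  differences within \<open>A \<inter> B\<close>, where both signs of \<open>y - z\<close> can be
  tested, so the lemma on orthogonal sums applies.\<close>

lemma polyhedron_Fix_reflections:
  fixes A B :: "'a::euclidean_space set"
  assumes A: "polyhedron A" and B: "polyhedron B" and z: "z \<in> A \<inter> B" and \<alpha>: "\<alpha> \<noteq> 0"
  shows "polyhedron (Fix (gDR_operator \<alpha> A 2 B 2))"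
proof -
  have "difference_polar A B
      = {u. \<forall>y\<in>A. u \<bullet> (y - z) \<le> 0} \<inter> {u. - u + 0 \<in> {u. \<forall>y\<in>B. u \<bullet> (y - z) \<le> 0}}"
  proof (intro set_eqI iffI)
    fix u assume "u \<in> difference_polar A B"
    then have d: "\<And>a b. a \<in> A \<Longrightarrow> b \<in> B \<Longrightarrow> u \<bullet> (a - b) \<le> 0" by (simp add: difference_polar_def)
    have "u \<bullet> (y - z) \<le> 0" if "y \<in> A" for y using d that z by blast
    moreover have "- u \<bullet> (y - z) \<le> 0" if "y \<in> B" for y
      using d[of z y] that z by (simp add: inner_diff_right)
    ultimately show "u \<in> {u. \<forall>y\<in>A. u \<bullet> (y - z) \<le> 0} \<inter> {u. - u + 0 \<in> {u. \<forall>y\<in>B. u \<bullet> (y - z) \<le> 0}}"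
      by simp
  next
    fix u assume u: "u \<in> {u. \<forall>y\<in>A. u \<bullet> (y - z) \<le> 0} \<inter> {u. - u + 0 \<in> {u. \<forall>y\<in>B. u \<bullet> (y - z) \<le> 0}}"
    have "u \<bullet> (a - b) \<le> 0" if "a \<in> A" "b \<in> B" for a b
    proof -
      have "u \<bullet> (a - z) \<le> 0" "- u \<bullet> (b - z) \<le> 0" using u that by auto
      then show ?thesis by (simp add: inner_diff_right)
    qed
    then show "u \<in> difference_polar A B" by (simp add: difference_polar_def)
  qed
  moreover have "linear (uminus :: 'a \<Rightarrow> 'a)" by (rule linear_uminus)
  ultimately have "polyhedron (difference_polar A B)"
    using polyhedron_normal_cone[OF A, of z] polyhedron_normal_cone[OF B, of z] z
    by (simp only: polyhedron_Int polyhedron_linear_preimage Int_iff)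
  moreover have "u \<bullet> (y - z) = 0" if "u \<in> difference_polar A B" "y \<in> A \<inter> B" for u y
  proof -
    have "u \<bullet> (y - z) \<le> 0" "u \<bullet> (z - y) \<le> 0" using that z by (auto simp: difference_polar_def)
    then show ?thesis by (simp add: inner_diff_right)
  qed
  ultimately have "polyhedron ((A \<inter> B) + difference_polar A B)"
    using A B by (intro polyhedron_orthogonal_sum[of _ _ z]) auto
  moreover have "A \<noteq> {}" "B \<noteq> {}" using z by auto
  ultimately show ?thesis
    using A B \<alpha> by (simp add: Fix_reflections polyhedron_imp_closed polyhedron_imp_convex)
qed

text \<open>For polyhedra the triples \<open>(x, closest_point A x, closest_point B (2 a - x))\<close> are covered
  by finitely many polyhedra, one for each pair of active sets; Hoffman's bound is applied to the
  intersection of each piece with the subspace where the last two components agree. Pieces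
  missing that subspace keep a positive distance from it on bounded sets.\<close>

lemma gDR_error_bound_reflections_polyhedral:
  fixes A B :: "'a::euclidean_space set"
  assumes A: "polyhedron A" and B: "polyhedron B" and x0: "x0 \<in> A \<inter> B" and \<alpha>: "0 < \<alpha>"
  shows "\<exists>k\<ge>0. \<forall>x. norm (x - x0) \<le> R \<longrightarrow>
           (\<exists>z\<in>Fix (gDR_operator \<alpha> A 2 B 2). norm (x - z) \<le> k * norm (x - gDR_operator \<alpha> A 2 B 2 x))"
proof -
  note Acc = polyhedron_imp_closed[OF A] polyhedron_imp_convex[OF A]
  note Bcc = polyhedron_imp_closed[OF B] polyhedron_imp_convex[OF B]
  have ne: "A \<noteq> {}" "B \<noteq> {}" using x0 by auto
  have x0fix: "x0 \<in> Fix (gDR_operator \<alpha> A 2 B 2)"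
    using x0 Acc Bcc \<alpha> by (simp add: Fix_def gDR_operator_fixed_iff relaxed_projector_mem)
  obtain HA where HA: "finite HA" "A = {x. \<forall>(a,b)\<in>HA. a \<bullet> x \<le> b}"
    by (rule polyhedron_normalized_inequalities[OF A]) blast
  obtain HB where HB: "finite HB" "B = {x. \<forall>(a,b)\<in>HB. a \<bullet> x \<le> b}"
    by (rule polyhedron_normalized_inequalities[OF B]) blast
  define a where "a x = closest_point A x" for x
  define b where "b x = closest_point B (2 *\<^sub>R a x - x)" for x
  define e where "e x = norm (a x - b x)" for x
  define act where "act K = (\<Inter>p\<in>K. {y::'a. fst p \<bullet> y = snd p})" for K
  \<comment> \<open>Optimality conditions with prescribed tight inequalities: the points satisfy
    those of \<open>K\<close> and \<open>M\<close> with equality, and the residuals lie in the cones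
    of their normals. The added zeros match the affine form of
    \<open>polyhedron_linear_preimage\<close>.\<close>
  define Q where "Q K M = {w :: 'a \<times> 'a \<times> 'a. fst (snd w) + 0 \<in> A \<inter> act K}
      \<inter> {w. snd (snd w) + 0 \<in> B \<inter> act M}
      \<inter> {w. (fst w - fst (snd w)) + 0 \<in> convex_cone hull (fst ` K)}
      \<inter> {w. (2 *\<^sub>R fst (snd w) - fst w - snd (snd w)) + 0 \<in> convex_cone hull (fst ` M)}"
    for K M :: "('a \<times> real) set"
  define E where "E = {w :: 'a \<times> 'a \<times> 'a. (fst (snd w) - snd (snd w)) + 0 \<in> {0}}"
  have lin: "linear (\<lambda>w :: 'a \<times> 'a \<times> 'a. fst (snd w))" "linear (\<lambda>w :: 'a \<times> 'a \<times> 'a. snd (snd w))"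
    "linear (\<lambda>w :: 'a \<times> 'a \<times> 'a. fst w - fst (snd w))"
    "linear (\<lambda>w :: 'a \<times> 'a \<times> 'a. 2 *\<^sub>R fst (snd w) - fst w - snd (snd w))"
    "linear (\<lambda>w :: 'a \<times> 'a \<times> 'a. fst (snd w) - snd (snd w))"
    by (auto intro!: linearI simp: algebra_simps)
  have polyQ: "polyhedron (Q K M)" if "K \<in> Pow HA" "M \<in> Pow HB" for K M
  proof -
    have fin: "finite K" "finite M" using that HA(1) HB(1) finite_subset by auto
    have "polyhedron (act K)" "polyhedron (act M)"
      unfolding act_def using fin by (auto intro!: polyhedron_Inter polyhedron_hyperplane)
    then show ?thesis
      unfolding Q_def using A B fin lin
      by (intro polyhedron_Int polyhedron_linear_preimage polyhedron_convex_cone_hull) auto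
  qed
  have polyE: "polyhedron E"
    unfolding E_def by (intro polyhedron_linear_preimage lin affine_imp_polyhedron) simp
  have sound: "closest_point A x = y \<and> closest_point B (2 *\<^sub>R y - x) = y'"
    if "(x, y, y') \<in> Q K M" "K \<in> Pow HA" "M \<in> Pow HB" for x y y' K M
  proof
    have "y \<in> A" "y' \<in> B" using that(1) by (auto simp: Q_def)
    have "(x - y) \<bullet> (w - y) \<le> 0" if "w \<in> A" for w
      using \<open>(x, y, y') \<in> Q K M\<close> \<open>K \<in> Pow HA\<close> that HA(2)
      by (intro active_cone_subset_normal_cone[of K HA]) (auto simp: Q_def act_def)
    then show "closest_point A x = y" using Acc \<open>y \<in> A\<close> by (intro closest_point_eqI)
    have "(2 *\<^sub>R y - x - y') \<bullet> (w - y') \<le> 0" if "w \<in> B" for w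
      using \<open>(x, y, y') \<in> Q K M\<close> \<open>M \<in> Pow HB\<close> that HB(2)
      by (intro active_cone_subset_normal_cone[of M HB]) (auto simp: Q_def act_def)
    then show "closest_point B (2 *\<^sub>R y - x) = y'" using Bcc \<open>y' \<in> B\<close> by (intro closest_point_eqI)
  qed
  have complete: "\<exists>K\<in>Pow HA. \<exists>M\<in>Pow HB. (x, a x, b x) \<in> Q K M" for x
  proof (intro bexI)
    define K where "K = {p \<in> HA. fst p \<bullet> a x = snd p}"
    define M where "M = {p \<in> HB. fst p \<bullet> b x = snd p}"
    show "K \<in> Pow HA" "M \<in> Pow HB" by (auto simp: K_def M_def)
    have aA: "a x \<in> A" and bB: "b x \<in> B"
      using Acc Bcc ne by (auto simp: a_def b_def intro: closest_point_in_set)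
    have "x - a x \<in> convex_cone hull (fst ` K)" unfolding K_def
    proof (rule normal_vector_mem_convex_cone_hull_active[OF HA(1)])
      show "\<forall>(c,d)\<in>HA. c \<bullet> a x \<le> d" using aA HA(2) by blast
      show "(x - a x) \<bullet> (y - a x) \<le> 0" if "\<forall>(c,d)\<in>HA. c \<bullet> y \<le> d" for y
        unfolding a_def using Acc that HA(2) by (intro closest_point_dot) blast+
    qed
    moreover have "2 *\<^sub>R a x - x - b x \<in> convex_cone hull (fst ` M)" unfolding M_def
    proof (rule normal_vector_mem_convex_cone_hull_active[OF HB(1)])
      show "\<forall>(c,d)\<in>HB. c \<bullet> b x \<le> d" using bB HB(2) by blast
      show "(2 *\<^sub>R a x - x - b x) \<bullet> (y - b x) \<le> 0" if "\<forall>(c,d)\<in>HB. c \<bullet> y \<le> d" for y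
        unfolding b_def using Bcc that HB(2) by (intro closest_point_dot) blast+
    qed
    moreover have "a x \<in> act K" "b x \<in> act M" by (auto simp: act_def K_def M_def)
    ultimately show "(x, a x, b x) \<in> Q K M" using aA bB by (simp add: Q_def)
  qed
  have bounds: "norm (a x - x0) \<le> norm (x - x0)" "norm (b x - x0) \<le> norm (x - x0)" for x
    unfolding b_def a_def using x0 Acc Bcc
    by (auto intro: closest_point_norm_le closest_point_reflection_norm_le)
  have "\<exists>k\<ge>0. \<forall>KM\<in>Pow HA \<times> Pow HB. \<forall>x. norm (x - x0) \<le> R \<longrightarrow> (x, a x, b x) \<in> Q (fst KM) (snd KM) \<longrightarrow>
      (\<exists>z\<in>Fix (gDR_operator \<alpha> A 2 B 2). norm (x - z) \<le> k * e x)"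
  proof (rule finite_uniform_bound)
    show "finite (Pow HA \<times> Pow HB)" using HA HB by simp
    fix KM assume "KM \<in> Pow HA \<times> Pow HB"
    then obtain K M where KM: "KM = (K, M)" "K \<in> Pow HA" "M \<in> Pow HB" by auto
    show "\<exists>k\<ge>0. \<forall>x. norm (x - x0) \<le> R \<longrightarrow> (x, a x, b x) \<in> Q (fst KM) (snd KM) \<longrightarrow>
      (\<exists>z\<in>Fix (gDR_operator \<alpha> A 2 B 2). norm (x - z) \<le> k * e x)"
    proof (cases "Q K M \<inter> E = {}")
      case False
      have "\<exists>k\<ge>0. \<forall>w r. 0 \<le> r \<longrightarrow> (\<forall>S\<in>{Q K M, E}. \<exists>y\<in>S. norm (w - y) \<le> r) \<longrightarrow>
           (\<exists>z\<in>(\<Inter>S\<in>{Q K M, E}. S). norm (w - z) \<le> k * r)"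
        using False polyQ[OF KM(2,3)] polyE by (intro polyhedra_linearly_regular) auto
      then obtain k where k: "k \<ge> 0" "\<And>w r. 0 \<le> r \<Longrightarrow> (\<forall>S\<in>{Q K M, E}. \<exists>y\<in>S. norm (w - y) \<le> r) \<Longrightarrow>
           (\<exists>z\<in>(\<Inter>S\<in>{Q K M, E}. S). norm (w - z) \<le> k * r)" by blast
      have "\<exists>z\<in>Fix (gDR_operator \<alpha> A 2 B 2). norm (x - z) \<le> k * e x"
        if x: "(x, a x, b x) \<in> Q K M" for x
      proof -
        have e0: "0 \<le> e x" by (simp add: e_def)
        have "\<exists>y\<in>Q K M. norm ((x, a x, b x) - y) \<le> e x"
          using x e0 by (intro bexI[of _ "(x, a x, b x)"]) auto
        \<comment> \<open>Copying \<open>a x\<close> into the last component lands in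
          \<open>E\<close> at distance exactly \<open>e x\<close>.\<close>
        moreover have "\<exists>y\<in>E. norm ((x, a x, b x) - y) \<le> e x"
          by (intro bexI[of _ "(x, a x, a x)"]) (auto simp: e_def E_def norm_Pair norm_minus_commute)
        ultimately have "\<exists>z\<in>(\<Inter>S\<in>{Q K M, E}. S). norm ((x, a x, b x) - z) \<le> k * e x"
          by (intro k(2)[OF e0]) blast
        then obtain w where w: "w \<in> Q K M" "w \<in> E" "norm ((x, a x, b x) - w) \<le> k * e x" by auto
        obtain x' y' y'' where w': "w = (x', y', y'')" by (cases w) auto
        have "y'' = y'" using w(2) by (simp add: E_def w')
        then have "closest_point A x' = y'" "closest_point B (2 *\<^sub>R y' - x') = y'"
          using sound[OF _ KM(2,3)] w(1) w' by auto
        then have "x' \<in> Fix (gDR_operator \<alpha> A 2 B 2)"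
          using \<alpha> by (simp add: Fix_def reflections_fixed_iff)
        moreover have "norm (x - x') \<le> norm ((x, a x, b x) - w)"
          using norm_fst_le[of "x - x'" "(a x - y', b x - y'')"] by (simp add: w')
        ultimately show ?thesis using w(3) by (intro bexI[of _ x']) auto
      qed
      then show ?thesis using k(1) KM(1) by auto
    next
      case True
      define P where "P = Q K M \<inter> (cball x0 R \<times> cball x0 R \<times> cball x0 R)"
      have mem: "(x, a x, b x) \<in> P" if "norm (x - x0) \<le> R" "(x, a x, b x) \<in> Q K M" for x
        using that bounds[of x] unfolding P_def by (simp add: dist_norm norm_minus_commute)
      have "compact P"
        unfolding P_def using polyQ[OF KM(2,3)]
        by (intro closed_Int_compact polyhedron_imp_closed compact_Times compact_cball)
      show ?thesis
      proof (cases "P = {}")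
        case True
        then show ?thesis using mem KM(1) by (intro exI[of _ 0]) auto
      next
        case False
        have "continuous_on P (\<lambda>v. norm (fst (snd v) - snd (snd v)))" by (intro continuous_intros)
        from continuous_attains_inf[OF \<open>compact P\<close> False this]
        obtain w where w: "w \<in> P"
          "\<And>v. v \<in> P \<Longrightarrow> norm (fst (snd w) - snd (snd w)) \<le> norm (fst (snd v) - snd (snd v))"
          by blast
        define \<delta> where "\<delta> = norm (fst (snd w) - snd (snd w))"
        have "w \<notin> E" using w(1) True by (auto simp: P_def)
        then have \<delta>: "\<delta> > 0" by (simp add: \<delta>_def E_def)
        have R0: "R \<ge> 0" using w(1) by (cases w) (auto simp: P_def dest: order_trans[OF zero_le_dist])
        \<comment> \<open>On this piece \<open>e x\<close> is at least \<open>\<delta>\<close>, so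
          the fixed point \<open>x0\<close>, at distance at most \<open>R\<close>, already satisfies
          the bound.\<close>
        have "\<exists>z\<in>Fix (gDR_operator \<alpha> A 2 B 2). norm (x - z) \<le> R / \<delta> * e x"
          if "norm (x - x0) \<le> R" "(x, a x, b x) \<in> Q K M" for x
        proof (rule bexI[OF _ x0fix])
          have "\<delta> \<le> e x" using w(2)[OF mem[OF that]] by (simp add: \<delta>_def e_def)
          then have "R / \<delta> * \<delta> \<le> R / \<delta> * e x" using R0 \<delta> by (intro mult_left_mono) auto
          then show "norm (x - x0) \<le> R / \<delta> * e x" using that(1) \<delta> by simp
        qed
        then show ?thesis using KM(1) R0 \<delta> by (intro exI[of _ "R / \<delta>"]) auto
      qed
    qed
  next
    fix KM and k k' :: real
    assume *: "\<forall>x. norm (x - x0) \<le> R \<longrightarrow> (x, a x, b x) \<in> Q (fst KM) (snd KM) \<longrightarrow>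
      (\<exists>z\<in>Fix (gDR_operator \<alpha> A 2 B 2). norm (x - z) \<le> k * e x)" "k \<le> k'"
    have "k * e x \<le> k' * e x" for x using *(2) by (intro mult_right_mono) (auto simp: e_def)
    then show "\<forall>x. norm (x - x0) \<le> R \<longrightarrow> (x, a x, b x) \<in> Q (fst KM) (snd KM) \<longrightarrow>
      (\<exists>z\<in>Fix (gDR_operator \<alpha> A 2 B 2). norm (x - z) \<le> k' * e x)"
      using *(1) order_trans by blast
  qed
  then obtain k where k: "k \<ge> 0" "\<And>K M x. K \<in> Pow HA \<Longrightarrow> M \<in> Pow HB \<Longrightarrow> norm (x - x0) \<le> R \<Longrightarrow>
      (x, a x, b x) \<in> Q K M \<Longrightarrow> \<exists>z\<in>Fix (gDR_operator \<alpha> A 2 B 2). norm (x - z) \<le> k * e x"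
    by (metis fst_conv mem_Sigma_iff snd_conv)
  show ?thesis
  proof (intro exI[of _ "k / (2 * \<alpha>)"] conjI allI impI)
    show "0 \<le> k / (2 * \<alpha>)" using k(1) \<alpha> by simp
    fix x assume x: "norm (x - x0) \<le> R"
    have "k / (2 * \<alpha>) * norm (x - gDR_operator \<alpha> A 2 B 2 x) = k * e x"
      unfolding norm_reflections_displacement[OF \<alpha>] e_def a_def b_def using \<alpha> by simp
    then show "\<exists>z\<in>Fix (gDR_operator \<alpha> A 2 B 2).
        norm (x - z) \<le> k / (2 * \<alpha>) * norm (x - gDR_operator \<alpha> A 2 B 2 x)"
      using complete[of x] k(2)[OF _ _ x] by metis
  qed
qed

section \<open>Cyclic sequences\<close>

text \<open>Every later iterate stays in the ball of radius \<open>dz n\<close> around the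
  projection of \<open>X n\<close> onto \<open>Z\<close>, so the tail oscillates by at most
  \<open>2 * dz n\<close>. Geometric decay of \<open>dz\<close> over whole cycles therefore yields
  the limit together with its rate.\<close>

lemma fejer_converges_R_linearly:
  fixes X :: "nat \<Rightarrow> 'a::euclidean_space"
  assumes Z: "closed Z" "convex Z" "Z \<noteq> {}" and l: "l > 0"
    and mono: "\<And>n p. p \<in> Z \<Longrightarrow> norm (X (Suc n) - p) \<le> norm (X n - p)"
    and \<rho>: "0 \<le> \<rho>" "\<rho> < 1"
    and rate: "\<And>q. norm (X (Suc q * l) - closest_point Z (X (Suc q * l)))
        \<le> \<rho> * norm (X (q * l) - closest_point Z (X (q * l)))"
  shows "\<exists>xbar\<in>Z. converges_R_linearly X xbar"
proof -
  define dz where "dz n = norm (X n - closest_point Z (X n))" for n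
  have mono': "norm (X m - p) \<le> norm (X n - p)" if "n \<le> m" "p \<in> Z" for m n p
    using lift_Suc_antimono_le[of "\<lambda>n. norm (X n - p)" n m] mono[OF that(2)] that(1) by blast
  have PZ: "closest_point Z x \<in> Z" for x using Z by (intro closest_point_in_set)
  have dz_mono: "dz m \<le> dz n" if "n \<le> m" for m n
  proof -
    have "dz m \<le> norm (X m - closest_point Z (X n))"
      using closest_point_le[OF Z(1) PZ, of "X m" "X n"] by (simp add: dz_def dist_norm)
    also have "\<dots> \<le> dz n" unfolding dz_def by (rule mono'[OF that PZ])
    finally show ?thesis .
  qed
  have dz0: "0 \<le> dz n" for n by (simp add: dz_def)
  \<comment> \<open>Raising the factor to at least 1/2 keeps it positive, since
    \<open>\<sigma>\<close> divides by it.\<close>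
  define r where "r = max \<rho> (1/2)"
  have r: "0 < r" "r < 1" using \<rho> by (auto simp: r_def)
  have geo: "dz (q * l) \<le> dz 0 * r ^ q" for q
  proof (induction q)
    case 0 then show ?case by simp
  next
    case (Suc q)
    have "dz (Suc q * l) \<le> \<rho> * dz (q * l)" unfolding dz_def by (rule rate)
    also have "\<dots> \<le> r * (dz 0 * r ^ q)"
      using Suc r dz0 by (intro mult_mono) (auto simp: r_def)
    finally show ?case by (simp add: mult.left_commute)
  qed
  \<comment> \<open>The root spreads the contraction of one cycle over its \<open>l\<close> steps;
    the division by \<open>r\<close> in \<open>\<sigma>\<close> pays for an incomplete last
    cycle.\<close>
  define \<theta> where "\<theta> = root l r"
  have \<theta>: "0 < \<theta>" "\<theta> < 1" "\<theta> ^ l = r"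
    using r l by (auto simp: \<theta>_def)
  define \<sigma> where "\<sigma> = dz 0 / r"
  have \<sigma>: "0 \<le> \<sigma>" using dz0 r by (simp add: \<sigma>_def)
  have dz_le: "dz n \<le> \<sigma> * \<theta> ^ n" for n
  proof -
    have "\<theta> ^ l \<le> \<theta> ^ (n mod l)" using \<theta> l by (intro power_decreasing) auto
    then have "r ^ (n div l) * r \<le> r ^ (n div l) * \<theta> ^ (n mod l)"
      using r \<theta>(3) by (intro mult_left_mono) auto
    also have "\<dots> = \<theta> ^ (l * (n div l) + n mod l)" by (simp only: power_add power_mult \<theta>(3))
    finally have *: "r ^ (n div l) * r \<le> \<theta> ^ n" by simp
    have "dz n \<le> dz (n div l * l)" by (intro dz_mono) simp
    also have "\<dots> \<le> dz 0 * r ^ (n div l)" by (rule geo)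
    also have "\<dots> = \<sigma> * (r ^ (n div l) * r)" using r by (simp add: \<sigma>_def)
    also have "\<dots> \<le> \<sigma> * \<theta> ^ n" using * \<sigma> by (intro mult_left_mono)
    finally show ?thesis .
  qed
  have osc: "norm (X n - X m) \<le> 2 * dz n" if "n \<le> m" for n m
  proof -
    have "norm (X m - closest_point Z (X n)) \<le> dz n"
      unfolding dz_def by (rule mono'[OF that PZ])
    then show ?thesis
      using dist_triangle2[of "X n" "X m" "closest_point Z (X n)"] by (simp add: dz_def dist_norm)
  qed
  have lim0: "(\<lambda>n. \<sigma> * \<theta> ^ n) \<longlonglongrightarrow> 0"
    using \<theta> by (intro tendsto_mult_right_zero LIMSEQ_realpow_zero) auto
  have dz_lim: "dz \<longlonglongrightarrow> 0"
    using dz0 dz_le by (intro tendsto_sandwich[OF _ _ tendsto_const lim0] always_eventually) auto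
  have "Cauchy X"
  proof (rule metric_CauchyI)
    fix e :: real assume "0 < e"
    then obtain N where N: "\<And>n. n \<ge> N \<Longrightarrow> norm (dz n - 0) < e / 4"
      using LIMSEQ_D[OF dz_lim, of "e / 4"] by auto
    have "dist (X m) (X n) < e" if "m \<ge> N" "n \<ge> N" for m n
      using dist_triangle3[of "X m" "X n" "X N"] osc[OF that(1)] osc[OF that(2)] N[of N] \<open>0 < e\<close>
      by (simp add: dist_norm)
    then show "\<exists>M. \<forall>m\<ge>M. \<forall>n\<ge>M. dist (X m) (X n) < e" by blast
  qed
  then obtain xbar where xbar: "X \<longlonglongrightarrow> xbar" using Cauchy_convergent convergent_def by blast
  have le: "norm (X n - xbar) \<le> 2 * dz n" for n
  proof (rule LIMSEQ_le_const2)
    show "(\<lambda>m. norm (X n - X m)) \<longlonglongrightarrow> norm (X n - xbar)" by (intro tendsto_intros xbar)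
    show "\<exists>N. \<forall>m\<ge>N. norm (X n - X m) \<le> 2 * dz n" using osc by blast
  qed
  have "(\<lambda>n. X n - closest_point Z (X n)) \<longlonglongrightarrow> 0"
    using dz_lim unfolding dz_def by (rule tendsto_norm_zero_cancel)
  then have "(\<lambda>n. X n - (X n - closest_point Z (X n))) \<longlonglongrightarrow> xbar - 0"
    using xbar by (intro tendsto_diff)
  then have "(\<lambda>n. closest_point Z (X n)) \<longlonglongrightarrow> xbar" by simp
  then have "xbar \<in> Z" using Z(1) PZ by (meson closed_sequentially)
  moreover have "converges_R_linearly X xbar"
    unfolding converges_R_linearly_def
  proof (intro exI conjI allI)
    show "0 \<le> \<theta>" "\<theta> < 1" "0 \<le> 2 * \<sigma>" using \<theta> \<sigma> by auto
    show "norm (X n - xbar) \<le> 2 * \<sigma> * \<theta> ^ n" for n using le[of n] dz_le[of n] by linarith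
  qed
  ultimately show ?thesis by blast
qed

text \<open>If the distance to a point of the intersection hardly decreases over a cycle, all steps
  of the cycle are short, so its starting point is near every \<open>Y j\<close> at once, and
  regularity makes it near the intersection.\<close>

lemma cyclic_sequence_converges_R_linearly:
  fixes T :: "nat \<Rightarrow> 'a::euclidean_space \<Rightarrow> 'a" and Y :: "nat \<Rightarrow> 'a set"
  assumes l: "l > 0"
    and clo: "\<And>j. j \<in> {1..l} \<Longrightarrow> closed (Y j)" and cvx: "\<And>j. j \<in> {1..l} \<Longrightarrow> convex (Y j)"
    and x0: "\<And>j. j \<in> {1..l} \<Longrightarrow> x0 \<in> Y j"
    and fejer: "\<And>j. j \<in> {1..l} \<Longrightarrow> \<exists>k\<ge>0. \<forall>x. \<forall>p\<in>Y j. norm (T j x - p) \<le> norm (x - p) \<and>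
        (norm (x - T j x))\<^sup>2 \<le> k * ((norm (x - p))\<^sup>2 - (norm (T j x - p))\<^sup>2)"
    and err: "\<And>j R. j \<in> {1..l} \<Longrightarrow> \<exists>k\<ge>0. \<forall>x. norm (x - x0) \<le> R \<longrightarrow>
        (\<exists>y\<in>Y j. norm (x - y) \<le> k * norm (x - T j x))"
    and qual: "\<And>j. j \<in> {1..l} \<Longrightarrow> polyhedron (Y j) \<or> x0 \<in> rel_interior (Y j)"
  shows "\<exists>xbar\<in>(\<Inter>j\<in>{1..l}. Y j). converges_R_linearly (cyclic_sequence l T z) xbar"
proof -
  define Z where "Z = (\<Inter>j\<in>{1..l}. Y j)"
  have "closed Z" "convex Z" "x0 \<in> Z"
    using clo cvx x0 by (auto simp: Z_def intro!: closed_INT convex_INT)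
  then have Z: "closed Z" "convex Z" "x0 \<in> Z" "Z \<noteq> {}" by auto
  define X where "X = cyclic_sequence l T z"
  have ix: "n mod l + 1 \<in> {1..l}" for n using l by (simp add: Suc_leI)
  have X_Suc: "X (Suc n) = T (n mod l + 1) (X n)" for n by (simp add: X_def)
  have "\<exists>k\<ge>0. \<forall>j\<in>{1..l}. \<forall>x. \<forall>p\<in>Y j. norm (T j x - p) \<le> norm (x - p) \<and>
        (norm (x - T j x))\<^sup>2 \<le> k * ((norm (x - p))\<^sup>2 - (norm (T j x - p))\<^sup>2)"
  proof (rule finite_uniform_bound[OF _ fejer])
    fix j and k k' :: real
    assume *: "\<forall>x. \<forall>p\<in>Y j. norm (T j x - p) \<le> norm (x - p) \<and>
        (norm (x - T j x))\<^sup>2 \<le> k * ((norm (x - p))\<^sup>2 - (norm (T j x - p))\<^sup>2)" and k: "k \<le> k'"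
    show "\<forall>x. \<forall>p\<in>Y j. norm (T j x - p) \<le> norm (x - p) \<and>
        (norm (x - T j x))\<^sup>2 \<le> k' * ((norm (x - p))\<^sup>2 - (norm (T j x - p))\<^sup>2)"
    proof (intro allI ballI conjI)
      fix x p assume p: "p \<in> Y j"
      show 1: "norm (T j x - p) \<le> norm (x - p)" using * p by blast
      then have "(norm (T j x - p))\<^sup>2 \<le> (norm (x - p))\<^sup>2" by (intro power_mono) auto
      then have "k * ((norm (x - p))\<^sup>2 - (norm (T j x - p))\<^sup>2)
          \<le> k' * ((norm (x - p))\<^sup>2 - (norm (T j x - p))\<^sup>2)" using k by (intro mult_right_mono) auto
      then show "(norm (x - T j x))\<^sup>2 \<le> k' * ((norm (x - p))\<^sup>2 - (norm (T j x - p))\<^sup>2)"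
        using * p order_trans by blast
    qed
  qed simp_all
  then obtain c where c: "c \<ge> 0"
    "\<And>j x p. j \<in> {1..l} \<Longrightarrow> p \<in> Y j \<Longrightarrow> norm (T j x - p) \<le> norm (x - p)"
    "\<And>j x p. j \<in> {1..l} \<Longrightarrow> p \<in> Y j \<Longrightarrow>
        (norm (x - T j x))\<^sup>2 \<le> c * ((norm (x - p))\<^sup>2 - (norm (T j x - p))\<^sup>2)" by blast
  have ZY: "p \<in> Y j" if "p \<in> Z" "j \<in> {1..l}" for p j using that by (auto simp: Z_def)
  have mono: "norm (X (Suc n) - p) \<le> norm (X n - p)" if "p \<in> Z" for n p
    unfolding X_Suc by (rule c(2)[OF ix ZY[OF that ix]])
  have mono': "norm (X m - p) \<le> norm (X n - p)" if "n \<le> m" "p \<in> Z" for m n p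
    using lift_Suc_antimono_le[of "\<lambda>n. norm (X n - p)" n m] mono[OF that(2)] that(1) by blast
  \<comment> \<open>Fejer monotonicity with respect to \<open>x0\<close> confines the orbit to the
    ball of this radius, so bounds valid on bounded sets suffice.\<close>
  define R where "R = norm (z - x0)"
  have XR: "norm (X n - x0) \<le> R" for n
    using mono'[of 0 n x0] Z(3) by (simp add: X_def R_def)
  have "\<exists>k\<ge>0. \<forall>j\<in>{1..l}. \<forall>x. norm (x - x0) \<le> R \<longrightarrow> (\<exists>y\<in>Y j. norm (x - y) \<le> k * norm (x - T j x))"
  proof (rule finite_uniform_bound[OF _ err])
    fix j and k k' :: real
    assume *: "\<forall>x. norm (x - x0) \<le> R \<longrightarrow> (\<exists>y\<in>Y j. norm (x - y) \<le> k * norm (x - T j x))" "k \<le> k'"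
    have "k * norm (x - T j x) \<le> k' * norm (x - T j x)" for x using *(2) by (intro mult_right_mono) auto
    then show "\<forall>x. norm (x - x0) \<le> R \<longrightarrow> (\<exists>y\<in>Y j. norm (x - y) \<le> k' * norm (x - T j x))"
      using *(1) order_trans by blast
  qed simp_all
  then obtain k1 where k1: "k1 \<ge> 0" "\<And>j x. j \<in> {1..l} \<Longrightarrow> norm (x - x0) \<le> R \<Longrightarrow>
      (\<exists>y\<in>Y j. norm (x - y) \<le> k1 * norm (x - T j x))" by blast
  obtain k2 where k2: "k2 \<ge> 0" "\<And>x e. norm (x - x0) \<le> R \<Longrightarrow> 0 \<le> e \<Longrightarrow>
      (\<forall>j\<in>{1..l}. \<exists>y\<in>Y j. norm (x - y) \<le> e) \<Longrightarrow> (\<exists>y\<in>Z. norm (x - y) \<le> k2 * e)"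
    using boundedly_linearly_regular[of "{1..l}" Y x0 R] clo cvx x0 qual unfolding Z_def by auto
  define d where "d x = norm (x - closest_point Z x)" for x
  have PZ: "closest_point Z x \<in> Z" for x using Z by (intro closest_point_in_set)
  \<comment> \<open>The distance at the start of a cycle is at most
    \<open>k2 * (l + k1) * E\<close>, where the square of \<open>E\<close> is \<open>c * G\<close>;
    the summand 1 gives \<open>M \<ge> 1\<close>.\<close>
  define M where "M = (k2 * (l + k1))\<^sup>2 * c + 1"
  have M: "M \<ge> 1" using c(1) by (simp add: M_def)
  have cycle: "(d (X (Suc q * l)))\<^sup>2 \<le> (1 - 1 / M) * (d (X (q * l)))\<^sup>2" for q
  proof -
    define n where "n = q * l"
    define p where "p = closest_point Z (X n)"
    have pZ: "p \<in> Z" unfolding p_def by (rule PZ)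
    define G where "G = (norm (X n - p))\<^sup>2 - (norm (X (n + l) - p))\<^sup>2"
    have G0: "0 \<le> G" unfolding G_def using mono'[OF _ pZ, of n "n + l"] by (simp add: power_mono)
    \<comment> \<open>By monotonicity no single step loses more than the whole cycle, so
      \<open>E\<close> bounds the length of each step.\<close>
    define E where "E = sqrt (c * G)"
    have E0: "0 \<le> E" using c(1) G0 by (simp add: E_def)
    have step: "norm (X (n + i) - X (Suc (n + i))) \<le> E" if i: "i < l" for i
    proof -
      have "(norm (X (n + i) - X (Suc (n + i))))\<^sup>2
          \<le> c * ((norm (X (n + i) - p))\<^sup>2 - (norm (X (Suc (n + i)) - p))\<^sup>2)"
        unfolding X_Suc by (rule c(3)[OF ix ZY[OF pZ ix]])
      also have "\<dots> \<le> c * G" unfolding G_def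
        using mono'[OF _ pZ, of n "n + i"] mono'[OF _ pZ, of "Suc (n + i)" "n + l"] i c(1)
        by (intro mult_left_mono diff_mono power_mono) auto
      finally show ?thesis unfolding E_def by (rule real_le_rsqrt)
    qed
    have drift: "norm (X n - X (n + i)) \<le> i * E" if "i \<le> l" for i
      using that
    proof (induction i)
      case 0 then show ?case by simp
    next
      case (Suc i)
      have "norm (X n - X (n + Suc i)) \<le> norm (X n - X (n + i)) + norm (X (n + i) - X (Suc (n + i)))"
        using dist_triangle[of "X n" "X (n + Suc i)" "X (n + i)"] by (simp add: dist_norm)
      then show ?case using Suc step[of i] by (simp add: algebra_simps)
    qed
    have "\<forall>j\<in>{1..l}. \<exists>y\<in>Y j. norm (X n - y) \<le> (l + k1) * E"
    proof
      fix j assume j: "j \<in> {1..l}"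
      \<comment> \<open>Operator \<open>j\<close> acts at time \<open>n + i\<close> with
        \<open>j = i + 1\<close>, because \<open>n\<close> is a multiple of
        \<open>l\<close>.\<close>
      obtain i where ji: "j = Suc i" "i < l" using j by (cases j) auto
      then have i: "i < l" "(n + i) mod l + 1 = j" by (auto simp: n_def)
      obtain y where y: "y \<in> Y j" "norm (X (n + i) - y) \<le> k1 * norm (X (n + i) - T j (X (n + i)))"
        using k1(2)[OF j XR] by blast
      have "norm (X (n + i) - T j (X (n + i))) \<le> E" using step[OF i(1)] i(2) by (simp add: X_Suc)
      then have "norm (X (n + i) - y) \<le> k1 * E" using y(2) k1(1) mult_left_mono order_trans by blast
      moreover have "norm (X n - X (n + i)) \<le> l * E"
        using drift[of i] i(1) E0 by (smt (verit) less_imp_le mult_right_mono of_nat_le_iff)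
      ultimately have "norm (X n - y) \<le> (l + k1) * E"
        using dist_triangle[of "X n" y "X (n + i)"] by (simp add: dist_norm algebra_simps)
      then show "\<exists>y\<in>Y j. norm (X n - y) \<le> (l + k1) * E" using y(1) by blast
    qed
    then obtain y where y: "y \<in> Z" "norm (X n - y) \<le> k2 * ((l + k1) * E)"
      using k2(2)[OF XR, of "(l + k1) * E"] E0 k1(1) by auto
    have "d (X n) \<le> k2 * (l + k1) * E"
      using closest_point_le[OF Z(1) y(1), of "X n"] y(2) by (simp add: d_def dist_norm mult.assoc)
    then have "(d (X n))\<^sup>2 \<le> (k2 * (l + k1) * E)\<^sup>2"
      by (intro power_mono) (simp_all add: d_def)
    also have "\<dots> = (k2 * (l + k1))\<^sup>2 * c * G"
      using c(1) G0 by (simp add: power_mult_distrib E_def)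
    also have "\<dots> \<le> M * G" using G0 by (simp add: M_def algebra_simps)
    also have "\<dots> \<le> M * ((d (X n))\<^sup>2 - (d (X (n + l)))\<^sup>2)"
    proof (intro mult_left_mono)
      have "d (X (n + l)) \<le> norm (X (n + l) - p)"
        using closest_point_le[OF Z(1) pZ, of "X (n + l)"] by (simp add: d_def dist_norm)
      then have "(d (X (n + l)))\<^sup>2 \<le> (norm (X (n + l) - p))\<^sup>2"
        by (intro power_mono) (simp_all add: d_def)
      then show "G \<le> (d (X n))\<^sup>2 - (d (X (n + l)))\<^sup>2" by (simp add: G_def d_def p_def)
    qed (use M in simp)
    finally have "(d (X (n + l)))\<^sup>2 \<le> (1 - 1 / M) * (d (X n))\<^sup>2"
      using M by (simp add: field_simps)
    then show ?thesis by (simp add: n_def add.commute)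
  qed
  define \<rho> where "\<rho> = sqrt (1 - 1 / M)"
  have \<rho>: "0 \<le> \<rho>" "\<rho> < 1" using M by (auto simp: \<rho>_def)
  have "\<exists>xbar\<in>Z. converges_R_linearly X xbar"
  proof (rule fejer_converges_R_linearly[where X = X and Z = Z and l = l and \<rho> = \<rho>,
        OF Z(1,2,4) l mono \<rho>])
    fix q
    have "d (X (Suc q * l)) \<le> sqrt ((1 - 1 / M) * (d (X (q * l)))\<^sup>2)"
      using cycle[of q] by (rule real_le_rsqrt)
    also have "\<dots> = \<rho> * d (X (q * l))" by (simp add: real_sqrt_mult \<rho>_def d_def)
    finally show "norm (X (Suc q * l) - closest_point Z (X (Suc q * l)))
        \<le> \<rho> * norm (X (q * l) - closest_point Z (X (q * l)))" by (simp only: d_def)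
  qed
  then show ?thesis by (simp only: Z_def X_def)
qed

section \<open>A single pair of sets and its target set\<close>

locale gDR_pair =
  fixes A B :: "'a::euclidean_space set" and lam mu \<alpha> :: real and x0 :: 'a
  assumes A: "closed A" "convex A" and B: "closed B" "convex B" and x0: "x0 \<in> A \<inter> B"
    and lam: "0 < lam" "lam \<le> 2" and mu: "0 < mu" "mu \<le> 2"
    and \<alpha>: "0 < \<alpha>" "\<alpha> < 1 + beta_hat lam mu"
    and qual: "polyhedron A \<and> polyhedron B \<or> x0 \<in> rel_interior A \<inter> rel_interior B"
begin

text \<open>For two reflections every clause defining \<open>Y j\<close> is the fixed point set,
  because the sum in the relative interior clause equals it (\<open>target_eq\<close>). The sum is
  recovered where its shape matters.\<close>

definition target :: "'a set" where
  "target = (if min lam mu < 2 then A \<inter> B else Fix (gDR_operator \<alpha> A lam B mu))"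

lemma nonempty: "A \<noteq> {}" "B \<noteq> {}" using x0 by auto

lemma lam_mu_cases:
  obtains "min lam mu < 2" | "lam = 2" "mu = 2"
proof (cases "min lam mu < 2")
  case True
  then show ?thesis by (rule that(1))
next
  case False
  then have "lam = 2" "mu = 2" using lam mu by auto
  then show ?thesis by (rule that(2))
qed

lemma target_eq:
  "target = (if min lam mu < 2 then A \<inter> B
     else if lam = 2 \<and> mu = 2 \<and> rel_interior A \<inter> rel_interior B \<noteq> {}
       then (A \<inter> B) + (minkowski_diff (affine hull (A \<union> B)) (affine hull (A \<union> B)))\<^sup>\<bottom>
     else Fix (gDR_operator \<alpha> A lam B mu))"
  using Fix_reflections_rel_interior[OF A B _ \<alpha>(1)] by (auto simp: target_def)

lemma target_subset_Fix: "target \<subseteq> Fix (gDR_operator \<alpha> A lam B mu)"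
  using A B \<alpha> by (auto simp: target_def Fix_def gDR_operator_fixed_iff relaxed_projector_mem)

lemma target_fixed_cases:
  "p \<in> target \<Longrightarrow> p \<in> A \<inter> B \<or> lam = 2 \<and> mu = 2 \<and> gDR_operator \<alpha> A lam B mu p = p"
  using lam mu by (auto simp: target_def Fix_def split: if_splits)

lemma Fix_eq_sum: "lam = 2 \<Longrightarrow> mu = 2 \<Longrightarrow> target = (A \<inter> B) + difference_polar A B"
  using Fix_reflections[OF A B nonempty, of \<alpha>] \<alpha> unfolding target_def by simp

lemma closed_target: "closed target"
  unfolding target_def using A B nonempty by (auto intro: closed_Fix_gDR_operator)

lemma convex_target: "convex target"
proof (cases rule: lam_mu_cases)
  case 1
  then show ?thesis using A B by (auto simp: target_def intro: convex_Int)
next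
  case 2
  then show ?thesis
    unfolding Fix_eq_sum[OF 2]
    using A B by (intro convex_set_plus convex_Int convex_difference_polar)
qed

lemma x0_target: "x0 \<in> target"
  using x0 A B \<alpha> by (auto simp: target_def Fix_def gDR_operator_fixed_iff relaxed_projector_mem)

text \<open>For regularity of the whole family, \<open>x0\<close> must qualify for the target as
  well. In the non-polyhedral reflection case relative interiors add, and a subspace is its own
  relative interior, so \<open>x0 + 0\<close> is relatively interior to the sum.\<close>

lemma target_qualified: "polyhedron target \<or> x0 \<in> rel_interior target"
proof (cases "polyhedron A \<and> polyhedron B")
  case True
  then show ?thesis
    using polyhedron_Fix_reflections[of A B x0 \<alpha>] x0 \<alpha>
    unfolding target_def by (cases rule: lam_mu_cases) auto
next
  case False
  then have ri: "x0 \<in> rel_interior A \<inter> rel_interior B" using qual by blast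
  then have ri2: "x0 \<in> rel_interior (A \<inter> B)"
    using convex_rel_interior_inter_two[OF A(2) B(2)] by blast
  show ?thesis
  proof (cases rule: lam_mu_cases)
    case 1
    then show ?thesis using ri2 by (simp add: target_def)
  next
    case 2
    define V where "V = (minkowski_diff (affine hull (A \<union> B)) (affine hull (A \<union> B)))\<^sup>\<bottom>"
    have V: "subspace V" unfolding V_def by (rule subspace_orthogonal_comp)
    have "target = (A \<inter> B) + V" using ri 2 unfolding target_eq V_def by auto
    moreover have "rel_interior ((A \<inter> B) + V) = rel_interior (A \<inter> B) + rel_interior V"
      by (rule rel_interior_sum[OF convex_Int[OF A(2) B(2)] subspace_imp_convex[OF V]])
    moreover have "0 \<in> rel_interior V"
      using V by (simp add: rel_interior_affine subspace_imp_affine subspace_0)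
    ultimately show ?thesis using set_plus_intro[OF ri2, of 0] by simp
  qed
qed

lemma fejer:
  "\<exists>k\<ge>0. \<forall>x. \<forall>p\<in>target. norm (gDR_operator \<alpha> A lam B mu x - p) \<le> norm (x - p) \<and>
     (norm (x - gDR_operator \<alpha> A lam B mu x))\<^sup>2
       \<le> k * ((norm (x - p))\<^sup>2 - (norm (gDR_operator \<alpha> A lam B mu x - p))\<^sup>2)"
proof (intro exI[of _ "\<alpha> / (1 + beta_hat lam mu - \<alpha>)"] conjI allI ballI)
  show "0 \<le> \<alpha> / (1 + beta_hat lam mu - \<alpha>)" using \<alpha> by simp
  fix x p assume "p \<in> target"
  note p = gDR_operator_fejer[OF A B nonempty lam mu \<alpha> target_fixed_cases[OF this]]
  show "norm (gDR_operator \<alpha> A lam B mu x - p) \<le> norm (x - p)" by (rule p(1))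
  show "(norm (x - gDR_operator \<alpha> A lam B mu x))\<^sup>2 \<le> \<alpha> / (1 + beta_hat lam mu - \<alpha>) *
      ((norm (x - p))\<^sup>2 - (norm (gDR_operator \<alpha> A lam B mu x - p))\<^sup>2)" by (rule p(2))
qed

lemma error_bound:
  "\<exists>k\<ge>0. \<forall>x. norm (x - x0) \<le> R \<longrightarrow>
     (\<exists>y\<in>target. norm (x - y) \<le> k * norm (x - gDR_operator \<alpha> A lam B mu x))"
proof (cases rule: lam_mu_cases)
  case 1
  have reg: "\<exists>k\<ge>0. \<forall>x e. norm (x - x0) \<le> R \<longrightarrow> 0 \<le> e \<longrightarrow> (\<exists>y\<in>A. norm (x - y) \<le> e) \<longrightarrow>
      (\<exists>y\<in>B. norm (x - y) \<le> e) \<longrightarrow> (\<exists>z\<in>A \<inter> B. norm (x - z) \<le> k * e)" for R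
  proof -
    have "\<exists>k\<ge>0. \<forall>x e. norm (x - x0) \<le> R \<longrightarrow> 0 \<le> e \<longrightarrow> (\<forall>S\<in>{A, B}. \<exists>y\<in>S. norm (x - y) \<le> e) \<longrightarrow>
           (\<exists>z\<in>(\<Inter>S\<in>{A, B}. S). norm (x - z) \<le> k * e)"
      using A B x0 qual by (intro boundedly_linearly_regular) auto
    then obtain k where "k \<ge> 0" "\<And>x e. norm (x - x0) \<le> R \<Longrightarrow> 0 \<le> e \<Longrightarrow>
        (\<forall>S\<in>{A, B}. \<exists>y\<in>S. norm (x - y) \<le> e) \<Longrightarrow> (\<exists>z\<in>(\<Inter>S\<in>{A, B}. S). norm (x - z) \<le> k * e)"
      by blast
    then show ?thesis by (intro exI[of _ k]) auto
  qed
  show ?thesis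
    using gDR_error_bound_underrelaxed[OF A B x0 lam mu 1 \<alpha>(1) reg, of R] 1 by (simp add: target_def)
next
  case 2
  show ?thesis
  proof (cases "polyhedron A \<and> polyhedron B")
    case True
    then show ?thesis
      using gDR_error_bound_reflections_polyhedral[of A B x0 \<alpha> R] x0 \<alpha>(1) 2
      unfolding target_def by simp
  next
    case False
    then have ri: "x0 \<in> rel_interior A \<inter> rel_interior B" using qual by blast
    then have "target = (A \<inter> B) + (minkowski_diff (affine hull (A \<union> B)) (affine hull (A \<union> B)))\<^sup>\<bottom>"
      using 2 unfolding target_eq by auto
    then show ?thesis
      using gDR_error_bound_reflections_rel_interior[OF A B ri \<alpha>(1), of R]
      by (simp only: 2)
  qed
qed

text \<open>Only the projection onto the first set is covered: for two reflections
  \<open>x = z + u\<close> with \<open>u\<close> normal to \<open>A\<close> at \<open>z\<close>,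
  whereas for \<open>B\<close> it is \<open>- u\<close> that is normal. This asymmetry is why full
  connectivity uses directed edges.\<close>

lemma closest_point_target: "x \<in> target \<Longrightarrow> closest_point A x \<in> A \<inter> B"
proof (cases rule: lam_mu_cases)
  case 1
  assume "x \<in> target"
  then show ?thesis using 1 by (simp add: target_def closest_point_self)
next
  case 2
  assume "x \<in> target"
  then obtain z u where "x = z + u" "z \<in> A \<inter> B" "u \<in> difference_polar A B"
    unfolding Fix_eq_sum[OF 2] by (auto elim: set_plus_elim)
  then show ?thesis using closest_point_add_difference_polar(1)[OF A B] by simp
qed

lemma target_subset_Int:
  assumes "lam = 2 \<and> mu = 2 \<longrightarrow> 0 \<in> interior (minkowski_diff B A)"
  shows "target \<subseteq> A \<inter> B"
proof (cases rule: lam_mu_cases)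
  case 1
  then show ?thesis by (simp add: target_def)
next
  case 2
  then obtain e where e: "e > 0" "ball 0 e \<subseteq> minkowski_diff B A"
    using assms mem_interior by blast
  have "u = 0" if u: "u \<in> difference_polar A B" for u
  proof -
    \<comment> \<open>The negative of \<open>u\<close> scaled by \<open>t\<close> is short enough to
      be some \<open>b - a\<close>; testing \<open>u\<close> against \<open>a - b\<close> then gives
      \<open>t * (u \<bullet> u) \<le> 0\<close>.\<close>
    define t where "t = e / (norm u + 1)"
    have t: "t > 0" using e(1) by (simp add: t_def add_nonneg_pos)
    have "t * norm u < e" using e(1) by (simp add: t_def divide_simps add_nonneg_pos)
    then have "- (t *\<^sub>R u) \<in> ball 0 e" using t by simp
    then obtain a b where ab: "a \<in> A" "b \<in> B" "- (t *\<^sub>R u) = b - a"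
      using e(2) unfolding minkowski_diff_def by blast
    then have "a - b = t *\<^sub>R u" by (metis minus_diff_eq minus_minus)
    moreover have "u \<bullet> (a - b) \<le> 0" using u ab by (simp add: difference_polar_def)
    ultimately have "t * (u \<bullet> u) \<le> 0" by simp
    then have "u \<bullet> u \<le> 0" using t by (simp add: mult_le_0_iff)
    then show "u = 0" by (metis inner_gt_zero_iff not_less)
  qed
  then show ?thesis unfolding Fix_eq_sum[OF 2] by (metis add.right_neutral set_plus_elim subsetI)
qed

text \<open>In the reflection case the shift \<open>u\<close> is orthogonal to both sets, so
  \<open>u\<close> and \<open>- u\<close> both lie in the polar and either projection of
  \<open>z + u\<close> returns \<open>z\<close>.\<close>

lemma closest_points_agree:
  assumes "lam = 2 \<and> mu = 2 \<longrightarrow> rel_interior A \<inter> rel_interior B \<noteq> {}" and x: "x \<in> target"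
  shows "closest_point A x = closest_point B x"
proof (cases rule: lam_mu_cases)
  case 1
  then show ?thesis using x by (simp add: target_def closest_point_self)
next
  case 2
  then have "x \<in> (A \<inter> B) + (minkowski_diff (affine hull (A \<union> B)) (affine hull (A \<union> B)))\<^sup>\<bottom>"
    using assms unfolding target_eq by simp
  then obtain z u where zu: "x = z + u" "z \<in> A \<inter> B"
    "u \<in> (minkowski_diff (affine hull (A \<union> B)) (affine hull (A \<union> B)))\<^sup>\<bottom>"
    by (auto elim: set_plus_elim)
  have "\<forall>w\<in>A \<union> B. u \<bullet> (w - x0) = 0"
    using zu(3) x0 by (subst (asm) orthogonal_comp_affine_differences[of x0]) auto
  then have "u \<in> difference_polar A B" "- u \<in> difference_polar A B"
    by (auto simp: difference_polar_def inner_diff_right)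
  then show ?thesis
    using closest_point_add_difference_polar[OF A B zu(2)] zu(1) by fastforce
qed

end

section \<open>Projections of the limit point and the assembled theorem\<close>

lemma converges_R_linearly_closest_point:
  fixes S :: "'a::euclidean_space set"
  assumes "closed S" "convex S" "S \<noteq> {}" "converges_R_linearly X xbar"
  shows "converges_R_linearly (\<lambda>n. closest_point S (X n)) (closest_point S xbar)"
proof -
  have "norm (closest_point S x - closest_point S y) \<le> norm (x - y)" for x y
    using closest_point_lipschitz[OF assms(2,1,3), of x y] by (simp add: dist_norm)
  then show ?thesis using assms(4) order_trans unfolding converges_R_linearly_def by meson
qed

text \<open>Around the cycle \<open>i 1, ..., i r\<close> the distances from \<open>x\<close> are non-increasing, hence
  constant, and uniqueness of nearest points forces all the projections to coincide.\<close>

lemma fully_connected_closest_point: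
  fixes C :: "nat \<Rightarrow> 'a::euclidean_space set"
  assumes fc: "fully_connected_algorithm I l s t"
    and C: "\<And>i. i \<in> I \<Longrightarrow> closed (C i)" "\<And>i. i \<in> I \<Longrightarrow> convex (C i)"
    and ne: "\<And>i. i \<in> I \<Longrightarrow> C i \<noteq> {}"
    and edge: "\<And>j. j \<in> {1..l} \<Longrightarrow> closest_point (C (s j)) x \<in> C (s j) \<inter> C (t j)"
  shows "\<exists>k\<in>I. closest_point (C k) x \<in> (\<Inter>i\<in>I. C i)"
proof -
  from fc[unfolded fully_connected_algorithm_def] obtain r q i
    where conj: "1 \<le> r \<and> r \<le> q \<and> q \<le> l \<and> i ` {1..q} = I \<and>
        (if r = 1 then {} else {(i k, i (k + 1)) | k. k \<in> {1..<r}} \<union> {(i r, i 1)})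
        \<union> {(i 1, i k) | k. k \<in> {r + 1..q}} \<subseteq> {(s j, t j) | j. j \<in> {1..l}}"
    by (elim exE)
  then have rq: "1 \<le> r" "r \<le> q" "i ` {1..q} = I"
    and sub: "(if r = 1 then {} else {(i k, i (k + 1)) | k. k \<in> {1..<r}} \<union> {(i r, i 1)})
        \<union> {(i 1, i k) | k. k \<in> {r + 1..q}} \<subseteq> {(s j, t j) | j. j \<in> {1..l}}"
    by (simp_all only: simp_thms)
  define P where "P k = closest_point (C (i k)) x" for k
  define d where "d k = dist x (P k)" for k
  have iI: "i k \<in> I" if "k \<in> {1..q}" for k using rq(3) that by blast
  have E: "closest_point (C u) x \<in> C u \<inter> C v" if "(u, v) \<in> {(s j, t j) | j. j \<in> {1..l}}" for u v
    using that edge by blast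
  have tail: "P 1 \<in> C (i k)" if "k \<in> {r + 1..q}" for k
    using E[of "i 1" "i k"] sub that unfolding P_def by blast
  have next_mem: "P k \<in> C (i (k + 1))" if "k \<in> {1..<r}" for k
  proof -
    have "r \<noteq> 1" "(i k, i (k + 1)) \<in> {(i k, i (k + 1)) | k. k \<in> {1..<r}}" using that by auto
    then have "(i k, i (k + 1)) \<in> {(s j, t j) | j. j \<in> {1..l}}" using sub by (simp only: if_False) blast
    then show ?thesis using E unfolding P_def by blast
  qed
  have last_mem: "P r \<in> C (i 1)" if "r \<noteq> 1"
  proof -
    have "(i r, i 1) \<in> {(s j, t j) | j. j \<in> {1..l}}" using sub that by (simp only: if_False) blast
    then show ?thesis using E unfolding P_def by blast
  qed
  have d_Suc: "d (k + 1) \<le> d k" if "k \<in> {1..<r}" for k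
    unfolding d_def P_def using next_mem[OF that] C(1) iI that rq
    by (intro closest_point_le) (auto simp: P_def)
  have d_anti: "d m \<le> d k" if "1 \<le> k" "k \<le> m" "m \<le> r" for k m
    using that(2,3)
  proof (induction m rule: dec_induct)
    case base then show ?case by simp
  next
    case (step m)
    then show ?case using d_Suc[of m] that(1) by simp
  qed
  have d1r: "d 1 \<le> d r"
  proof (cases "r = 1")
    case False
    then show ?thesis unfolding d_def P_def using last_mem C(1) iI rq
      by (intro closest_point_le) (auto simp: P_def)
  qed simp
  have P1: "P k = P 1" if "1 \<le> k" "k \<le> r" for k
    using that
  proof (induction k rule: dec_induct)
    case base then show ?case by simp
  next
    case (step k)
    have k: "k \<in> {1..<r}" using step by auto
    have "d k \<le> d (k + 1)"
      using d_anti[of 1 k] d_anti[of "k + 1" r] d1r k by auto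
    \<comment> \<open>Distances are constant along the cycle, so \<open>P k\<close>, which lies in
      the next set, is already a nearest point of that set.\<close>
    have "P k = closest_point (C (i (k + 1))) x"
    proof (rule closest_point_unique)
      show "convex (C (i (k + 1)))" "closed (C (i (k + 1)))" using C iI k rq by auto
      show "P k \<in> C (i (k + 1))" by (rule next_mem[OF k])
      show "\<forall>z\<in>C (i (k + 1)). dist x (P k) \<le> dist x z"
        using \<open>d k \<le> d (k + 1)\<close> closest_point_le[of "C (i (k + 1))" _ x] C(1)[of "i (k + 1)"] iI[of "k + 1"] k rq
        unfolding d_def P_def by force
    qed
    then show ?case using step by (simp add: P_def)
  qed
  have "P 1 \<in> C (i k)" if "k \<in> {1..q}" for k
  proof (cases "k \<le> r")
    case True
    with that have "P k = P 1" using P1[of k] by simp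
    moreover have "P k \<in> C (i k)"
      unfolding P_def using C(1) ne iI[OF that] by (intro closest_point_in_set)
    ultimately show ?thesis by simp
  next
    case False
    then show ?thesis using tail that by auto
  qed
  then have "P 1 \<in> (\<Inter>i\<in>I. C i)" using rq(3) by blast
  moreover have "i 1 \<in> I" using iI rq by simp
  ultimately show ?thesis unfolding P_def by blast
qed

theorem theorem5p11:
  fixes m l :: nat
    and I J I\<^sub>p :: "nat set"
    and C :: "nat \<Rightarrow> 'a::euclidean_space set"
    and lam mu \<alpha> :: "nat \<Rightarrow> real"
    and s t :: "nat \<Rightarrow> nat"
    and T :: "nat \<Rightarrow> 'a \<Rightarrow> 'a"
    and L Y :: "nat \<Rightarrow> 'a set"
  assumes m_pos: "m > 0" and l_pos: "l > 0"
    and I_def: "I = {1..m}" and J_def: "J = {1..l}"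
    and closed_C: "\<And>i. i \<in> I \<Longrightarrow> closed (C i)"
    and C_nonempty: "(\<Inter>i\<in>I. C i) \<noteq> {}"
    and lambda_range: "\<And>j. j \<in> J \<Longrightarrow> 0 < lam j \<and> lam j \<le> 2"
    and mu_range: "\<And>j. j \<in> J \<Longrightarrow> 0 < mu j \<and> mu j \<le> 2"
    and alpha_range: "\<And>j. j \<in> J \<Longrightarrow> 0 < \<alpha> j \<and> \<alpha> j < 1 + beta_hat (lam j) (mu j)"
    and st_in_I: "\<And>j. j \<in> J \<Longrightarrow> s j \<in> I \<and> t j \<in> I"
    and st_distinct: "\<And>j. j \<in> J \<Longrightarrow> s j \<noteq> t j"
    and st_cover: "s ` J \<union> t ` J = I"
    and T_def: "\<And>j. j \<in> J \<Longrightarrow> T j = gDR_operator (\<alpha> j) (C (s j)) (lam j) (C (t j)) (mu j)"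
    and L_def: "\<And>j. j \<in> J \<Longrightarrow> L j = affine hull (C (s j) \<union> C (t j))"
    and convex_C: "\<And>i. i \<in> I \<Longrightarrow> convex (C i)"
    and I\<^sub>p_def: "I\<^sub>p = {i \<in> I. \<forall>k. (i, k) \<in> {(s j, t j) | j. j \<in> J} \<union> {(t j, s j) | j. j \<in> J}
                          \<longrightarrow> polyhedron (C i) \<and> polyhedron (C k)}"
    and qualification: "(\<Inter>i\<in>I\<^sub>p. C i) \<inter> (\<Inter>i\<in>I - I\<^sub>p. rel_interior (C i)) \<noteq> {}"
    and Y_def: "\<And>j. j \<in> J \<Longrightarrow> Y j =
          (if min (lam j) (mu j) < 2 then C (s j) \<inter> C (t j)
           else if lam j = 2 \<and> mu j = 2 \<and> rel_interior (C (s j)) \<inter> rel_interior (C (t j)) \<noteq> {}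
             then (C (s j) \<inter> C (t j)) + (minkowski_diff (L j) (L j))\<^sup>\<bottom>
           else Fix (T j))"
  shows "(\<Inter>j\<in>J. Y j) \<subseteq> (\<Inter>j\<in>J. Fix (T j)) \<and>
    (\<forall>x\<^sub>0. \<exists>xbar.
      \<comment> \<open>(i)\<close>
      converges_R_linearly (cyclic_sequence l T x\<^sub>0) xbar \<and>
      xbar \<in> (\<Inter>j\<in>J. Y j) \<and>
      (\<forall>i\<in>I. converges_R_linearly (\<lambda>n. closest_point (C i) (cyclic_sequence l T x\<^sub>0 n))
                (closest_point (C i) xbar)) \<and>
      \<comment> \<open>(ii)\<close>
      ((\<forall>j\<in>J. lam j = 2 \<and> mu j = 2 \<longrightarrow> 0 \<in> interior (minkowski_diff (C (t j)) (C (s j))))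
         \<longrightarrow> xbar \<in> (\<Inter>i\<in>I. C i)) \<and>
      \<comment> \<open>(iii)\<close>
      (connected_algorithm I J s t \<and>
       (\<forall>j\<in>J. lam j = 2 \<and> mu j = 2 \<longrightarrow>
          rel_interior (C (s j)) \<inter> rel_interior (C (t j)) \<noteq> {})
         \<longrightarrow> (\<exists>p \<in> (\<Inter>i\<in>I. C i). \<forall>i\<in>I. closest_point (C i) xbar = p)) \<and>
      \<comment> \<open>(iv)\<close>
      (fully_connected_algorithm I l s t
         \<longrightarrow> (\<exists>k\<in>I. closest_point (C k) xbar \<in> (\<Inter>i\<in>I. C i))))"
proof -
  obtain c where c: "c \<in> (\<Inter>i\<in>I\<^sub>p. C i) \<inter> (\<Inter>i\<in>I - I\<^sub>p. rel_interior (C i))"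
    using qualification by blast
  have cC: "c \<in> C i" if "i \<in> I" for i
    using c that rel_interior_subset[of "C i"] by (cases "i \<in> I\<^sub>p") auto
  have ne: "C i \<noteq> {}" if "i \<in> I" for i using cC[OF that] by auto
  define W where "W j = gDR_pair.target (C (s j)) (C (t j)) (lam j) (mu j) (\<alpha> j)" for j
  have pair: "gDR_pair (C (s j)) (C (t j)) (lam j) (mu j) (\<alpha> j) c" if j: "j \<in> J" for j
  proof
    have st: "s j \<in> I" "t j \<in> I" using st_in_I[OF j] by auto
    show "closed (C (s j))" "convex (C (s j))" "closed (C (t j))" "convex (C (t j))"
      "c \<in> C (s j) \<inter> C (t j)"
      using closed_C convex_C cC st by auto
    show "0 < lam j" "lam j \<le> 2" "0 < mu j" "mu j \<le> 2" "0 < \<alpha> j" "\<alpha> j < 1 + beta_hat (lam j) (mu j)"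
      using lambda_range[OF j] mu_range[OF j] alpha_range[OF j] by auto
    have edge: "(s j, t j) \<in> {(s j, t j) | j. j \<in> J} \<union> {(t j, s j) | j. j \<in> J}"
      "(t j, s j) \<in> {(s j, t j) | j. j \<in> J} \<union> {(t j, s j) | j. j \<in> J}" using j by auto
    show "polyhedron (C (s j)) \<and> polyhedron (C (t j))
        \<or> c \<in> rel_interior (C (s j)) \<inter> rel_interior (C (t j))"
    \<comment> \<open>One index in \<open>I\<^sub>p\<close> already makes both sets polyhedral,
      because \<open>I\<^sub>p\<close> looks along edges in both directions.\<close>
    proof (cases "s j \<in> I\<^sub>p \<or> t j \<in> I\<^sub>p")
      case True
      then show ?thesis using edge unfolding I\<^sub>p_def by blast
    next
      case False
      then show ?thesis using c st by auto
    qed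
  qed
  have YW: "Y j = W j" if j: "j \<in> J" for j
    unfolding W_def gDR_pair.target_eq[OF pair[OF j]] Y_def[OF j] L_def[OF j] T_def[OF j] by simp
  have WFix: "W j \<subseteq> Fix (T j)" if j: "j \<in> J" for j
    using gDR_pair.target_subset_Fix[OF pair[OF j]] by (simp only: W_def T_def[OF j])
  have conv: "\<exists>xbar\<in>(\<Inter>j\<in>J. W j). converges_R_linearly (cyclic_sequence l T x) xbar" for x
    unfolding J_def
  proof (rule cyclic_sequence_converges_R_linearly[OF l_pos])
    fix j assume "j \<in> {1..l}"
    then have j: "j \<in> J" by (simp add: J_def)
    note p = pair[OF j]
    show "closed (W j)" unfolding W_def by (rule gDR_pair.closed_target[OF p])
    show "convex (W j)" unfolding W_def by (rule gDR_pair.convex_target[OF p])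
    show "c \<in> W j" unfolding W_def by (rule gDR_pair.x0_target[OF p])
    show "polyhedron (W j) \<or> c \<in> rel_interior (W j)"
      unfolding W_def by (rule gDR_pair.target_qualified[OF p])
    show "\<exists>k\<ge>0. \<forall>x. \<forall>p\<in>W j. norm (T j x - p) \<le> norm (x - p) \<and>
        (norm (x - T j x))\<^sup>2 \<le> k * ((norm (x - p))\<^sup>2 - (norm (T j x - p))\<^sup>2)"
      unfolding W_def T_def[OF j] by (rule gDR_pair.fejer[OF p])
    show "\<exists>k\<ge>0. \<forall>x. norm (x - c) \<le> R \<longrightarrow> (\<exists>y\<in>W j. norm (x - y) \<le> k * norm (x - T j x))" for R
      unfolding W_def T_def[OF j] by (rule gDR_pair.error_bound[OF p])
  qed
  have ii: "x \<in> (\<Inter>i\<in>I. C i)"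
    if x: "x \<in> (\<Inter>j\<in>J. W j)"
      and int: "\<forall>j\<in>J. lam j = 2 \<and> mu j = 2 \<longrightarrow> 0 \<in> interior (minkowski_diff (C (t j)) (C (s j)))" for x
  proof -
    have "x \<in> C (s j) \<inter> C (t j)" if "j \<in> J" for j
      using gDR_pair.target_subset_Int[OF pair[OF that]] x int that unfolding W_def by blast
    then show ?thesis unfolding st_cover[symmetric] by blast
  qed
  have proj: "closest_point (C (s j)) x \<in> C (s j) \<inter> C (t j)" if "x \<in> (\<Inter>j\<in>J. W j)" "j \<in> J" for x j
    using gDR_pair.closest_point_target[OF pair[OF that(2)]] that unfolding W_def by blast
  have iii: "\<exists>p\<in>(\<Inter>i\<in>I. C i). \<forall>i\<in>I. closest_point (C i) x = p"
    if x: "x \<in> (\<Inter>j\<in>J. W j)" and con: "connected_algorithm I J s t"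
      and ri: "\<forall>j\<in>J. lam j = 2 \<and> mu j = 2 \<longrightarrow>
          rel_interior (C (s j)) \<inter> rel_interior (C (t j)) \<noteq> {}" for x
  proof -
    have agree: "closest_point (C (s j)) x = closest_point (C (t j)) x" if "j \<in> J" for j
      using gDR_pair.closest_points_agree[OF pair[OF that]] x ri that unfolding W_def by blast
    \<comment> \<open>Equality of projections propagates along paths, hence over the connected
      graph; the common value then lies in every set, being its nearest point.\<close>
    have "closest_point (C u) x = closest_point (C v) x"
      if "(u, v) \<in> ({(s j, t j) | j. j \<in> J} \<union> {(t j, s j) | j. j \<in> J})\<^sup>*" for u v
      using that by (induction rule: rtrancl_induct) (auto simp: agree)
    then have eq: "closest_point (C i) x = closest_point (C 1) x" if "i \<in> I" for i
      using con that m_pos unfolding connected_algorithm_def I_def by auto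
    have "closest_point (C 1) x \<in> C i" if "i \<in> I" for i
      using closest_point_in_set[OF closed_C[OF that] ne[OF that], of x] eq[OF that] by simp
    then show ?thesis using eq by blast
  qed
  have iv: "\<exists>k\<in>I. closest_point (C k) x \<in> (\<Inter>i\<in>I. C i)"
    if "x \<in> (\<Inter>j\<in>J. W j)" "fully_connected_algorithm I l s t" for x
    by (rule fully_connected_closest_point[OF that(2) closed_C convex_C ne])
       (use proj[OF that(1)] J_def in auto)
  have YW': "(\<Inter>j\<in>J. Y j) = (\<Inter>j\<in>J. W j)" using YW by simp
  show ?thesis
    unfolding YW'
  proof (intro conjI allI)
    show "(\<Inter>j\<in>J. W j) \<subseteq> (\<Inter>j\<in>J. Fix (T j))" using WFix by blast
    fix x
    obtain xbar where xbar: "xbar \<in> (\<Inter>j\<in>J. W j)" "converges_R_linearly (cyclic_sequence l T x) xbar"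
      using conv by blast
    have "\<forall>i\<in>I. converges_R_linearly (\<lambda>n. closest_point (C i) (cyclic_sequence l T x n))
        (closest_point (C i) xbar)"
      using converges_R_linearly_closest_point[OF closed_C convex_C ne xbar(2)] by blast
    then show "\<exists>xbar.
      converges_R_linearly (cyclic_sequence l T x) xbar \<and>
      xbar \<in> (\<Inter>j\<in>J. W j) \<and>
      (\<forall>i\<in>I. converges_R_linearly (\<lambda>n. closest_point (C i) (cyclic_sequence l T x n))
                (closest_point (C i) xbar)) \<and>
      ((\<forall>j\<in>J. lam j = 2 \<and> mu j = 2 \<longrightarrow> 0 \<in> interior (minkowski_diff (C (t j)) (C (s j))))
         \<longrightarrow> xbar \<in> (\<Inter>i\<in>I. C i)) \<and>
      (connected_algorithm I J s t \<and>
       (\<forall>j\<in>J. lam j = 2 \<and> mu j = 2 \<longrightarrow>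
          rel_interior (C (s j)) \<inter> rel_interior (C (t j)) \<noteq> {})
         \<longrightarrow> (\<exists>p \<in> (\<Inter>i\<in>I. C i). \<forall>i\<in>I. closest_point (C i) xbar = p)) \<and>
      (fully_connected_algorithm I l s t
         \<longrightarrow> (\<exists>k\<in>I. closest_point (C k) xbar \<in> (\<Inter>i\<in>I. C i)))"
      using xbar ii[OF xbar(1)] iii[OF xbar(1)] iv[OF xbar(1)]
      by (intro exI[of _ xbar] conjI impI) blast+
  qed
qed

end
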